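(* Let $L$ be a relatively complemented modular lattice. Suppose that $\operatorname{Dim}L$ satisfies the following axiom: $$(\forall x,y,z)\bigl[x+z=y+z\Rightarrow(\exists t)(2t\leq z\text{ and }x+t=y+t)\bigr].$$ Then $L$ is normal. In addition, if $L$ has a zero and $a$ and $b$ are elements of $L$, then $a\approxeq b$ if and only if there are decompositions $$a=a_0\oplus a_1,\qquad b=b_0\oplus b_1$$ such that $a_0\sim b_0$ and $a_1\sim b_1$. Furthermore, if $a'$ (resp., $b'$) is any sectional complement of $a\wedge b$ in $a$ (resp., $b$), one can take $a_0\perp b_0$, $a_0\geq a'$, $b_0\geq b'$, and $a_1,b_1\leq a\wedge b$.
   Context: Lattices are not assumed to be bounded. For a lattice $L$, the dimension monoid $\operatorname{Dim}L$ is the commutative monoid defined by generators $\Delta(a,b)$ (for $a\leq b$ in $L$) and the relations: (D0) $\Delta(a,a)=0$; (D1) $\Delta(a,c)=\Delta(a,b)+\Delta(b,c)$ for $a\leq b\leq c$; (D2) $\Delta(a,a\vee b)=\Delta(a\wedge b,b)$ for all $a,b\in L$. The relation $\leq$ on $\operatorname{Dim}L$ is the algebraic preordering: $x\leq y$ iff $x+z=y$ for some $z$. A lattice is relatively complemented if every closed interval $[a,b]$ of it is complemented. In a modular lattice with zero, $x\perp y$ means $x\wedge y=0$, and $z=x\oplus y$ means $x\wedge y=0$ and $x\vee y=z$; this partial operation is commutative and associative, so finite sums $\oplus_{i<n}a_i$ make sense. A sectional complement of $u$ in $a$ (where $u\leq a$) is an element $v$ with $u\oplus v=a$. Elements $x,y$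 of a lattice are perspective, $x\sim y$, if there is $t$ with $x\wedge t=y\wedge t$ and $x\vee t=y\vee t$; projectivity $\approx$ is the transitive closure of $\sim$. Projectivity by decomposition: $a\approxeq b$ iff there are $n\in\omega$ and decompositions $a=\oplus_{i<n}a_i$, $b=\oplus_{i<n}b_i$ with $a_i\approx b_i$ for all $i<n$. A normal equivalence on a modular lattice $K$ with zero is an equivalence relation $\equiv$ on $K$ such that: (E1) $\equiv$ is additive ($x\equiv x'$, $y\equiv y'$ and both $x\oplus y$ and $x'\oplus y'$ defined imply $x\oplus y\equiv x'\oplus y'$) and refining (if $y\equiv x_0\oplus x_1$, then there are $y_0\equiv x_0$ and $y_1\equiv x_1$ with $y=y_0\oplus y_1$); (E2) $x\sim y$ implies $x\equiv y$; (E3) $x\perp y$ and $x\equiv y$ imply $x\sim y$. A modular lattice with zero is normal if there is at least one normal equivalence on it. A relatively complemented modular lattice (not necessarily with zero) is normal if each of its closed intervals is normal; for relatively complemented modular lattices with zero the two definitions agree. *)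

theory Defs
  imports "HOL-Library.Multiset"
begin

section \<open>Modular and relatively complemented lattices\<close>

class modular_lattice = lattice +
  assumes modular_law: "z \<le> x \<Longrightarrow> inf x (sup y z) = sup (inf x y) z"

class relatively_complemented_lattice = lattice +
  assumes relatively_complemented:
    "a \<le> x \<Longrightarrow> x \<le> b \<Longrightarrow> \<exists>y. a \<le> y \<and> y \<le> b \<and> inf x y = a \<and> sup x y = b"


section \<open>The dimension monoid of a lattice\<close>

text \<open>
  The elements of the type \<open>'a ivl\<close> index the generators \<open>\<Delta>(a,b)\<close> with \<open>a \<le> b\<close>. Finite
  multisets of them form the free commutative monoid on the generators, which is divided
  by the smallest monoid congruence that contains the relations (D0), (D1) and (D2).
  The function \<open>ivl\<close> is only meaningful for \<open>a \<le> b\<close>, and so is \<open>Delta\<close> below.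
\<close>

typedef (overloaded) 'a ivl = "{p :: 'a::order \<times> 'a. fst p \<le> snd p}"
  by (rule exI[of _ "(undefined, undefined)"]) simp

definition ivl :: "'a::order \<Rightarrow> 'a \<Rightarrow> 'a ivl" where
  "ivl a b = Abs_ivl (a, b)"

inductive dim_cong :: "'a::lattice ivl multiset \<Rightarrow> 'a ivl multiset \<Rightarrow> bool" where
  refl: "dim_cong A A"
| sym: "dim_cong A B \<Longrightarrow> dim_cong B A"
| trans: "dim_cong A B \<Longrightarrow> dim_cong B C \<Longrightarrow> dim_cong A C"
| add: "dim_cong A B \<Longrightarrow> dim_cong C D \<Longrightarrow> dim_cong (A + C) (B + D)"
| D0: "dim_cong {#ivl a a#} {#}"
| D1: "a \<le> b \<Longrightarrow> b \<le> c \<Longrightarrow> dim_cong {#ivl a c#} ({#ivl a b#} + {#ivl b c#})"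
| D2: "dim_cong {#ivl a (sup a b)#} {#ivl (inf a b) b#}"

quotient_type (overloaded) 'a Dim = "'a::lattice ivl multiset" / dim_cong
  by (intro equivpI reflpI sympI transpI) (blast intro: dim_cong.intros)+

instantiation Dim :: (lattice) comm_monoid_add
begin

lift_definition zero_Dim :: "'a Dim" is "{#}" .

lift_definition plus_Dim :: "'a Dim \<Rightarrow> 'a Dim \<Rightarrow> 'a Dim" is "(+)"
  by (rule dim_cong.add)

instance
  by standard (transfer; simp add: ac_simps dim_cong.refl)+

end

lift_definition Delta :: "'a::lattice \<Rightarrow> 'a \<Rightarrow> 'a Dim" is "\<lambda>a b. {#ivl a b#}" .

lemma Delta_D0: "Delta a a = 0"
  by transfer (rule dim_cong.D0)

lemma Delta_D1: "a \<le> b \<Longrightarrow> b \<le> c \<Longrightarrow> Delta a c = Delta a b + Delta b c"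
  by transfer (rule dim_cong.D1)

lemma Delta_D2: "Delta a (sup a b) = Delta (inf a b) b"
  by transfer (rule dim_cong.D2)

definition alg_le :: "'m::comm_monoid_add \<Rightarrow> 'm \<Rightarrow> bool" where
  "alg_le x y \<longleftrightarrow> (\<exists>z. x + z = y)"


section \<open>Perspectivity and normality\<close>

text \<open>
  The notions below are relative to a sublattice \<open>K\<close> of the ambient lattice, given by its
  carrier set, and, where one is needed, to an element \<open>zr\<close> that is the zero of \<open>K\<close>. For a
  closed interval \<open>K = {a..b}\<close> the zero is \<open>a\<close>.
\<close>

definition perp :: "'a::lattice \<Rightarrow> 'a \<Rightarrow> 'a \<Rightarrow> bool" where
  "perp zr x y \<longleftrightarrow> inf x y = zr"

definition oplus :: "'a::lattice \<Rightarrow> 'a \<Rightarrow> 'a \<Rightarrow> 'a \<Rightarrow> bool" where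
  "oplus zr x y z \<longleftrightarrow> inf x y = zr \<and> sup x y = z"

primrec finite_oplus :: "'a::lattice \<Rightarrow> (nat \<Rightarrow> 'a) \<Rightarrow> nat \<Rightarrow> 'a \<Rightarrow> bool" where
  "finite_oplus zr f 0 z \<longleftrightarrow> z = zr"
| "finite_oplus zr f (Suc n) z \<longleftrightarrow> (\<exists>u. finite_oplus zr f n u \<and> oplus zr u (f n) z)"

definition sectional_complement :: "'a::lattice \<Rightarrow> 'a \<Rightarrow> 'a \<Rightarrow> 'a \<Rightarrow> bool" where
  "sectional_complement zr u a v \<longleftrightarrow> u \<le> a \<and> oplus zr u v a"

definition perspective :: "'a::lattice set \<Rightarrow> 'a \<Rightarrow> 'a \<Rightarrow> bool" where
  "perspective K x y \<longleftrightarrow> x \<in> K \<and> y \<in> K \<and> (\<exists>t\<in>K. inf x t = inf y t \<and> sup x t = sup y t)"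

definition projective :: "'a::lattice set \<Rightarrow> 'a \<Rightarrow> 'a \<Rightarrow> bool" where
  "projective K = (perspective K)\<^sup>+\<^sup>+"

definition decomp_projective :: "'a::lattice set \<Rightarrow> 'a \<Rightarrow> 'a \<Rightarrow> 'a \<Rightarrow> bool" where
  "decomp_projective K zr a b \<longleftrightarrow>
    (\<exists>n f g. finite_oplus zr f n a \<and> finite_oplus zr g n b \<and> (\<forall>i<n. projective K (f i) (g i)))"

definition normal_equivalence :: "'a::lattice set \<Rightarrow> 'a \<Rightarrow> ('a \<times> 'a) set \<Rightarrow> bool" where
  "normal_equivalence K zr R \<longleftrightarrow>
    equiv K R \<and>
    (\<forall>x\<in>K. \<forall>x'\<in>K. \<forall>y\<in>K. \<forall>y'\<in>K. \<forall>z\<in>K. \<forall>z'\<in>K.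
      (x, x') \<in> R \<and> (y, y') \<in> R \<and> oplus zr x y z \<and> oplus zr x' y' z' \<longrightarrow> (z, z') \<in> R) \<and>
    (\<forall>y\<in>K. \<forall>x0\<in>K. \<forall>x1\<in>K. \<forall>z\<in>K. oplus zr x0 x1 z \<and> (y, z) \<in> R \<longrightarrow>
      (\<exists>y0\<in>K. \<exists>y1\<in>K. (y0, x0) \<in> R \<and> (y1, x1) \<in> R \<and> oplus zr y0 y1 y)) \<and>
    (\<forall>x\<in>K. \<forall>y\<in>K. perspective K x y \<longrightarrow> (x, y) \<in> R) \<and>
    (\<forall>x\<in>K. \<forall>y\<in>K. perp zr x y \<and> (x, y) \<in> R \<longrightarrow> perspective K x y)"

definition normal_with_zero :: "'a::lattice set \<Rightarrow> 'a \<Rightarrow> bool" where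
  "normal_with_zero K zr \<longleftrightarrow> (\<exists>R. normal_equivalence K zr R)"

definition normal_lattice :: "'a::{modular_lattice, relatively_complemented_lattice} itself \<Rightarrow> bool" where
  "normal_lattice (_ :: 'a itself) \<longleftrightarrow> (\<forall>a b :: 'a. a \<le> b \<longrightarrow> normal_with_zero {a..b} a)"

end

theory Submission
  imports Defs
begin

text \<open>
  Fix a zero \<open>z\<close> and write \<open>D(x) = \<Delta>(z,x)\<close>. Perspective elements have the same dimension, and
  everything reduces to one converse: if \<open>x \<and> y = z\<close> and \<open>D(x) = D(y)\<close>, then \<open>x \<sim> y\<close>
  (\<open>Delta_eq_persp\<close>). Given this, equality of dimensions is a normal equivalence on every interval.
  It also yields the decompositions. If \<open>D(a) = D(b)\<close>, then \<open>D(a') + D(a \<and> b) = D(b') + D(a \<and> b)\<close>,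
  so the axiom supplies \<open>t\<close> with \<open>D(a') + t = D(b') + t\<close> and disjoint \<open>u, r \<le> a \<and> b\<close> of dimension
  \<open>t\<close>. With \<open>a \<and> b = u \<oplus> r \<oplus> w\<close> one takes \<open>a\<^sub>0 = a' \<oplus> u\<close>, \<open>b\<^sub>0 = b' \<oplus> r\<close>, \<open>a\<^sub>1 = r \<oplus> w\<close> and
  \<open>b\<^sub>1 = u \<oplus> w\<close>. Here \<open>a\<^sub>0, b\<^sub>0\<close> are disjoint of the same dimension, and so are \<open>u, r\<close>.

  \<^bold>\<open>From dimensions to projectivities.\<close> Two elements have the same dimension only if they are
  projective by decomposition, and dimensions refine: \<open>D(x) = \<alpha> + \<beta>\<close> gives \<open>x = x\<^sub>1 \<oplus> x\<^sub>2\<close> with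
  \<open>D(x\<^sub>1) = \<alpha>\<close>, \<open>D(x\<^sub>2) = \<beta>\<close> (\<open>Delta_eq_imp_appr\<close>, \<open>Delta_eq_sum_refine\<close>). As the lattice need not
  have a zero, the connecting elements are only known to lie above some \<open>w \<le> z\<close>; but disjoint
  elements over \<open>z\<close> are perspective exactly if their complements over \<open>w\<close> are
  (\<open>persp_lower_iff\<close>).

  \<^bold>\<open>Three copies suffice.\<close> The only composition of perspectivities available in general is
  \<open>a \<sim> b \<sim> c \<Longrightarrow> a \<sim> c\<close> for \<open>a\<close> disjoint from \<open>b \<or> c\<close> (\<open>persp_trans\<close>). If \<open>p\<close> is one of three
  independent, mutually perspective elements, then, after cutting it into pieces, one can follow a
  chain of perspectivities from \<open>p\<close> such that each element on the way is perspective to two of the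
  copies and independent of them (\<open>reach_step\<close>). Hence disjoint elements with the dimension of such
  a \<open>p\<close>, or with a smaller one, are perspective (\<open>hpersp_dim_triplicated\<close>).

  \<^bold>\<open>A third copy.\<close> Let \<open>u \<sim> u'\<close> be disjoint and let \<open>r\<close>, disjoint from \<open>u \<or> u'\<close>, have the dimension
  of \<open>u\<close>. A chain from \<open>u\<close> to \<open>r\<close> has to leave \<open>u \<or> u'\<close>, and the first element outside it is
  perspective to \<open>u\<close> directly. So \<open>u\<close> is a sum of pieces with three copies (\<open>hpersp_dim_exit\<close>).

  \<^bold>\<open>The axiom.\<close> Let \<open>y \<sim> w\<close> be disjoint and let \<open>p, q \<le> y\<close> have the same dimension. By the axiom,
  \<open>p\<close> and \<open>q\<close> agree up to summands \<open>p\<^sub>0, q\<^sub>0\<close> to which the preceding paragraph applies: the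
  second copy of \<open>t\<close> and a part of \<open>p\<close> serve as \<open>r\<close> (\<open>common_part\<close>). This shortens a pair of perspectivities
  \<open>y \<sim> w \<sim> x\<close> to a piecewise perspectivity between \<open>y\<close> and \<open>x\<close> (\<open>persp_persp\<close>), and by induction
  it shortens every chain. Piecewise perspectivity of disjoint elements is perspectivity
  (\<open>pw_persp_disjoint\<close>).
\<close>

section \<open>Independence\<close>

lemma disjoint_ge:
  fixes a b :: "'a::lattice"
  shows "inf a b = z \<Longrightarrow> z \<le> a" "inf a b = z \<Longrightarrow> z \<le> b"
  by (metis inf.cobounded1) (metis inf.cobounded2)

lemma disjoint_mono:
  fixes a b :: "'a::lattice"
  assumes "inf a b = z" "a' \<le> a" "b' \<le> b" "z \<le> a'" "z \<le> b'"
  shows "inf a' b' = z"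
  using assms by (metis antisym inf.boundedI inf_mono)

lemma indep_shift:
  fixes a b c :: "'a::modular_lattice"
  assumes ab: "inf a b = z" and abc: "inf (sup a b) c = z"
  shows "inf a (sup b c) = z"
proof (rule antisym)
  have "inf a (sup b c) \<le> inf (sup a b) (sup c b)"
    by (metis inf_mono order_refl sup.commute sup_ge1)
  also have "\<dots> = sup (inf (sup a b) c) b"
    by (rule modular_law) simp
  also have "\<dots> = b"
    using ab abc by (metis inf.cobounded2 sup.absorb2)
  finally show "inf a (sup b c) \<le> z"
    using ab by (metis inf.bounded_iff inf.cobounded1)
  show "z \<le> inf a (sup b c)"
    using ab by (metis inf.boundedI inf.cobounded1 inf.cobounded2 le_supI1)
qed

text \<open>
  Any partition of an independent family \<open>a, b, c, d\<close> has disjoint joins; regrouping of sums rests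
  on this.
\<close>

lemma indep_pairs:
  fixes a b c d :: "'a::modular_lattice"
  assumes "inf a b = z" "inf c d = z" "inf (sup a b) (sup c d) = z"
  shows "inf (sup a c) (sup b d) = z"
proof -
  have "inf a (sup b (sup c d)) = z"
    using assms indep_shift by blast
  moreover have "inf c (sup d (sup a b)) = z"
    using assms indep_shift by (metis inf.commute)
  then have "inf c (sup b d) = z"
    by (rule disjoint_mono) (use disjoint_ge[OF assms(1)] disjoint_ge[OF assms(2)] in \<open>simp_all add: le_supI1 le_supI2\<close>)
  ultimately show ?thesis
    using indep_shift[of "sup b d" c z a] by (simp add: ac_simps)
qed

lemma oplus_commute: "oplus z a b c \<longleftrightarrow> oplus z b a c"
  by (simp add: oplus_def ac_simps)

lemma oplus_zero: "z \<le> a \<Longrightarrow> oplus z z a a" "z \<le> a \<Longrightarrow> oplus z a z a"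
  by (simp_all add: oplus_def inf.absorb1 inf.absorb2 sup.absorb1 sup.absorb2)

lemma oplus_le:
  assumes "oplus z a b c" shows "a \<le> c" "b \<le> c" "z \<le> a" "z \<le> b" "z \<le> c"
  using assms unfolding oplus_def by (metis sup_ge1, metis sup_ge2, (metis disjoint_ge le_supI1)+)

lemma oplus_assoc:
  fixes a b c :: "'a::modular_lattice"
  assumes "oplus z a b ab" "oplus z ab c abc"
  shows "oplus z b c (sup b c)" "oplus z a (sup b c) abc"
proof -
  have "inf b (sup a c) = z"
    using assms indep_shift[of b a z c] by (simp add: oplus_def ac_simps)
  then have "inf b c = z"
    by (rule disjoint_mono) (use oplus_le[OF assms(1)] oplus_le[OF assms(2)] in simp_all)
  then show "oplus z b c (sup b c)" by (simp add: oplus_def)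
  show "oplus z a (sup b c) abc"
    using assms indep_shift[of a b z c] by (auto simp: oplus_def sup_assoc)
qed

lemma oplus_interchange:
  fixes a b c d :: "'a::modular_lattice"
  assumes "oplus z a b x" "oplus z c d y" "oplus z x y v"
  shows "oplus z a c (sup a c)" "oplus z b d (sup b d)" "oplus z (sup a c) (sup b d) v"
proof -
  have xy: "inf x y = z" using assms by (simp add: oplus_def)
  show "oplus z a c (sup a c)" "oplus z b d (sup b d)"
    using disjoint_mono[OF xy] oplus_le[OF assms(1)] oplus_le[OF assms(2)] by (simp_all add: oplus_def)
  show "oplus z (sup a c) (sup b d) v"
    using indep_pairs[of a b z c d] assms by (auto simp: oplus_def ac_simps)
qed

lemma sectional_complement_exists:
  fixes z u a :: "'a::relatively_complemented_lattice"
  assumes "z \<le> u" "u \<le> a" obtains v where "oplus z u v a"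
  using relatively_complemented[OF assms] by (auto simp: oplus_def)

text \<open>
  Used for case distinctions: every element is cut into a part inside \<open>e\<close> and a part disjoint
  from \<open>e\<close>.
\<close>

lemma split_by:
  fixes z y e :: "'a::relatively_complemented_lattice"
  assumes "z \<le> y" "z \<le> e"
  obtains y2 where "oplus z (inf y e) y2 y" "inf y2 e = z"
proof -
  obtain v where v: "oplus z (inf y e) v y"
    using sectional_complement_exists assms by (metis inf.boundedI inf.cobounded1)
  then have "inf v e = inf (inf y e) v"
    using oplus_le(2)[OF v] by (metis inf.absorb_iff2 inf.assoc inf.commute)
  then show ?thesis using that v by (simp add: oplus_def)
qed

section \<open>Perspectivity over a zero\<close>

text \<open>
  For elements above \<open>z\<close> this agrees with perspectivity in the sublattice of all elements above
  \<open>z\<close>: an axis \<open>t\<close> may be replaced by a complement of \<open>x \<and> t = y \<and> t\<close> in \<open>t\<close> over \<open>z\<close>. A disjoint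
  axis makes \<open>z \<le> x, y\<close> automatic and transports decompositions.
\<close>

definition persp :: "'a::lattice \<Rightarrow> 'a \<Rightarrow> 'a \<Rightarrow> bool" where
  "persp z x y \<longleftrightarrow> (\<exists>s. inf x s = z \<and> inf y s = z \<and> sup x s = sup y s)"

lemma perspI: "inf x s = z \<Longrightarrow> inf y s = z \<Longrightarrow> sup x s = sup y s \<Longrightarrow> persp z x y"
  by (auto simp: persp_def)

lemma persp_refl: "z \<le> x \<Longrightarrow> persp z x x"
  by (auto simp: persp_def intro!: exI[of _ z] inf.absorb2)

lemma persp_sym: "persp z x y \<Longrightarrow> persp z y x"
  by (metis persp_def)

lemma persp_le: "persp z x y \<Longrightarrow> z \<le> x" "persp z x y \<Longrightarrow> z \<le> y"
  unfolding persp_def by (metis disjoint_ge(1))+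

lemma persp_zero: "persp z x z \<Longrightarrow> x = z"
  by (metis inf.absorb_iff1 inf_sup_absorb persp_def sup.absorb2 sup_ge1 sup.commute)

lemma persp_axis:
  fixes x y :: "'a::modular_lattice"
  assumes "persp z x y"
  obtains s where "inf x s = z" "inf y s = z" "sup x s = sup x y" "sup y s = sup x y" "s \<le> sup x y"
proof -
  obtain t where t: "inf x t = z" "inf y t = z" "sup x t = sup y t"
    using assms by (auto simp: persp_def)
  let ?s = "inf t (sup x y)"
  have "sup x ?s = inf (sup x y) (sup t x)"
    using modular_law[of x "sup x y" t] by (simp add: ac_simps)
  also have "\<dots> = sup x y"
    using t by (metis inf.absorb1 sup.commute sup.left_idem sup_ge1 le_supI sup_ge2)
  finally have x: "sup x ?s = sup x y" .
  have "sup y ?s = inf (sup x y) (sup t y)"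
    using modular_law[of y "sup x y" t] by (simp add: ac_simps)
  also have "\<dots> = sup x y"
    using t by (metis inf.absorb1 sup.commute sup.left_idem sup_ge1 le_supI sup_ge2)
  finally have y: "sup y ?s = sup x y" .
  have "inf x ?s = z" "inf y ?s = z"
    using t by (metis inf.absorb1 inf.assoc inf.commute sup_ge1 sup_ge2)+
  with x y that show ?thesis by simp
qed

text \<open>
  The map \<open>v \<mapsto> (v \<or> s) \<and> y\<close> is an isomorphism of \<open>[z,x]\<close> onto \<open>[z,y]\<close>, and every \<open>v\<close> is perspective
  to its image with the same axis \<open>s\<close>.
\<close>

lemma persp_split:
  fixes x y :: "'a::modular_lattice"
  assumes "persp z x y" "oplus z x1 x2 x"
  obtains y1 y2 where "oplus z y1 y2 y" "persp z x1 y1" "persp z x2 y2"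
proof -
  obtain s where s: "inf x s = z" "inf y s = z" "sup x s = sup y s"
    using assms by (auto simp: persp_def)
  have le: "x1 \<le> x" "x2 \<le> x" "z \<le> x1" "z \<le> x2" using oplus_le[OF assms(2)] by auto
  have part: "persp z v (inf (sup v s) y)" "sup (inf (sup v s) y) s = sup v s" if v: "v \<le> x" "z \<le> v" for v
  proof -
    have "sup (inf (sup v s) y) s = inf (sup v s) (sup y s)"
      using modular_law[of s "sup v s" y] by simp
    also have "\<dots> = sup v s"
      using s v by (metis inf.absorb1 sup_mono order_refl)
    finally show e: "sup (inf (sup v s) y) s = sup v s" .
    have "inf v s = z" using disjoint_mono[OF s(1)] v s by (metis inf.cobounded2 order_refl)
    moreover have "inf (inf (sup v s) y) s = z"
      using s by (metis inf.absorb1 inf.assoc inf.commute sup_ge2)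
    ultimately show "persp z v (inf (sup v s) y)" using e perspI by metis
  qed
  let ?y1 = "inf (sup x1 s) y" and ?y2 = "inf (sup x2 s) y"
  have d: "inf (sup x1 s) x2 = z"
    using indep_shift[of x2 x1 z s] assms s by (simp add: oplus_def ac_simps)
  have "inf (sup x1 s) (sup x2 s) = sup (inf (sup x1 s) x2) s"
    by (rule modular_law) simp
  also have "\<dots> = s" using d s by (metis inf.cobounded2 sup.absorb2)
  finally have "inf ?y1 ?y2 = z"
    using s by (metis inf.commute inf.left_commute inf.left_idem)
  moreover have "sup ?y1 ?y2 = y"
  proof -
    have "sup (sup ?y1 ?y2) s = sup x s"
      using part(2)[of x1] part(2)[of x2] le assms by (simp add: oplus_def) (metis sup.assoc sup.commute sup.left_idem)
    then have "y = inf y (sup (sup ?y1 ?y2) s)"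
      using s by (metis inf_sup_absorb)
    also have "\<dots> = inf y (sup s (sup ?y1 ?y2))" by (simp add: ac_simps)
    also have "\<dots> = sup (inf y s) (sup ?y1 ?y2)" by (rule modular_law) simp
    also have "\<dots> = sup ?y1 ?y2" using s \<open>inf ?y1 ?y2 = z\<close> by (metis inf_sup_ord(1) le_supI1 sup.absorb2)
    finally show ?thesis by simp
  qed
  ultimately show ?thesis using that part(1)[of x1] part(1)[of x2] le by (auto simp: oplus_def)
qed

text \<open>
  The join of the two axes, cut down to \<open>a \<or> c\<close>, is an axis. It is essential that \<open>a\<close> lies outside
  \<open>b \<or> c\<close>; perspectivity alone is not transitive.
\<close>

lemma persp_trans:
  fixes a b c :: "'a::modular_lattice"
  assumes ab: "persp z a b" and bc: "persp z b c" and d: "inf a (sup b c) = z"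
  shows "persp z a c"
proof -
  have zle: "z \<le> a" "z \<le> b" "z \<le> c" using ab bc persp_le by blast+
  obtain s where s: "inf a s = z" "inf b s = z" "sup a s = sup a b" "sup b s = sup a b" "s \<le> sup a b"
    using persp_axis[OF ab] .
  obtain t where t: "inf b t = z" "inf c t = z" "sup b t = sup b c" "sup c t = sup b c" "t \<le> sup b c"
    using persp_axis[OF bc] .
  \<comment> \<open>The axes lie in \<open>a \<or> b\<close> and \<open>b \<or> c\<close>, which meet only in \<open>b\<close>, and \<open>b\<close> is disjoint from both axes.\<close>
  have b: "inf (sup a b) (sup b c) = b"
  proof -
    have "inf (sup b c) (sup a b) = sup (inf (sup b c) a) b" by (rule modular_law) simp
    then show ?thesis using d zle by (metis inf.commute sup.absorb2)
  qed
  let ?r = "sup s t"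
  have "inf (sup a b) t \<le> sup b c" using t(5) by (rule le_infI2)
  then have "inf (sup a b) t \<le> inf (sup a b) (sup b c)" by simp
  then have "inf (sup a b) t \<le> inf b t" unfolding b by simp
  then have "inf (sup a b) t \<le> s" using t(1) s(1) by (metis inf.cobounded2 order_trans)
  moreover have "inf (sup a b) (sup t s) = sup (inf (sup a b) t) s" by (rule modular_law) (rule s)
  ultimately have "inf (sup a b) ?r = s" by (metis sup.absorb2 sup.commute)
  then have "inf a ?r = inf a s" by (metis inf.assoc inf_sup_absorb)
  then have ar: "inf a ?r = z" using s by simp
  have "inf (sup b c) s \<le> sup a b" using s(5) by (rule le_infI2)
  then have "inf (sup b c) s \<le> inf (sup a b) (sup b c)" by simp
  then have "inf (sup b c) s \<le> inf b s" unfolding b by simp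
  then have "inf (sup b c) s \<le> t" using s(2) t(1) by (metis inf.cobounded2 order_trans)
  moreover have "inf (sup b c) (sup s t) = sup (inf (sup b c) s) t" by (rule modular_law) (rule t)
  ultimately have "inf (sup b c) ?r = t" by (simp add: sup.absorb2)
  moreover have "inf c (sup b c) = c" by (simp add: inf.absorb1)
  ultimately have "inf c ?r = inf c t" by (metis inf.assoc)
  then have cr: "inf c ?r = z" using t by simp
  have "sup a ?r = sup c ?r"
  proof -
    have "sup a ?r = sup (sup a b) t" using s by (metis sup.assoc)
    also have "\<dots> = sup a (sup b c)" using t by (simp add: sup.assoc)
    also have "\<dots> = sup c (sup b s)" using s by (simp add: ac_simps)
    also have "\<dots> = sup (sup b c) s" by (simp add: ac_simps)
    also have "\<dots> = sup c ?r" unfolding t(4)[symmetric] by (simp add: ac_simps)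
    finally show ?thesis .
  qed
  with ar cr show ?thesis by (rule perspI)
qed

lemma persp_trans_middle:
  fixes a b c :: "'a::modular_lattice"
  assumes "persp z b a" "persp z b c" "inf a c = z" "inf b (sup a c) = z"
  shows "persp z a c"
proof -
  have "inf a (sup c b) = z" using indep_shift[of a c z b] assms by (simp add: ac_simps)
  then show ?thesis using assms persp_trans persp_sym by (metis sup.commute)
qed

lemma persp_oplus:
  fixes x y :: "'a::modular_lattice"
  assumes "oplus z x1 x2 x" "oplus z y1 y2 y" "inf x y = z" "persp z x1 y1" "persp z x2 y2"
  shows "persp z x y"
proof -
  have xy: "oplus z x y (sup x y)" using assms by (simp add: oplus_def)
  note q = oplus_interchange[OF assms(1,2) xy]
  obtain s where s: "inf x1 s = z" "inf y1 s = z" "sup x1 s = sup x1 y1" "sup y1 s = sup x1 y1" "s \<le> sup x1 y1"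
    using persp_axis[OF assms(4)] .
  obtain t where t: "inf x2 t = z" "inf y2 t = z" "sup x2 t = sup x2 y2" "sup y2 t = sup x2 y2" "t \<le> sup x2 y2"
    using persp_axis[OF assms(5)] .
  have d: "inf (sup x1 y1) (sup x2 y2) = z" using q by (simp add: oplus_def)
  have "inf (sup x1 x2) (sup s t) = z" "inf (sup y1 y2) (sup s t) = z"
    using indep_pairs[of x1 s z x2 t] indep_pairs[of y1 s z y2 t] s t d by auto
  moreover have "sup (sup x1 x2) (sup s t) = sup (sup y1 y2) (sup s t)"
    using s t by (metis sup.assoc sup.left_commute)
  ultimately show ?thesis using assms perspI by (metis oplus_def)
qed

lemma persp_add_common:
  fixes r u w :: "'a::modular_lattice"
  assumes "persp z r u" "inf (sup r u) w = z"
  shows "persp z (sup r w) (sup u w)"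
proof -
  obtain s where s: "inf r s = z" "inf u s = z" "sup r s = sup r u" "sup u s = sup r u"
    using persp_axis[OF assms(1)] .
  have "inf s (sup r w) = z" "inf s (sup u w) = z"
    using indep_shift[of s r z w] indep_shift[of s u z w] s assms(2) by (simp_all add: inf.commute sup.commute)
  then show ?thesis
    by (intro perspI[of _ s]) (use s in \<open>metis inf.commute inf.commute sup.assoc sup.commute\<close>)+
qed

lemma persp_complements:
  assumes "oplus z a u b" "oplus z a v b" shows "persp z u v"
  using assms by (intro perspI[of _ a]) (auto simp: oplus_def ac_simps)

text \<open>
  Splits a perspectivity into the identity on \<open>x \<and> y\<close> and a perspectivity of disjoint elements. The
  join of an axis with \<open>x \<and> y\<close> is cut down to \<open>x' \<or> y'\<close>.
\<close>

lemma persp_differences: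
  fixes x y :: "'a::modular_lattice"
  assumes "persp z x y" "oplus z (inf x y) x' x" "oplus z (inf x y) y' y"
  shows "persp z x' y'"
proof -
  obtain s where s: "inf x s = z" "inf y s = z" "sup x s = sup x y" "sup y s = sup x y"
    using persp_axis[OF assms(1)] .
  let ?m = "inf x y" and ?t = "inf (sup s (inf x y)) (sup x' y')"
  have key: "inf u' ?t = z \<and> sup u' ?t = sup x' y'"
    if "oplus z ?m u' u" "inf u s = z" "?m \<le> u" "sup u s = sup x y" "u' \<le> sup x' y'" for u u'
  proof
    have le: "u' \<le> u" "z \<le> u'" "z \<le> ?m" "u = sup ?m u'"
      using oplus_le[OF that(1)] that(1) by (auto simp: oplus_def)
    have "inf u (sup s ?m) = sup (inf u s) ?m" by (rule modular_law) (rule that)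
    also have "\<dots> = ?m" using that le by (simp add: sup.absorb2)
    finally have e: "inf u' (sup s ?m) = inf u' ?m" using le by (metis inf.absorb1 inf.assoc)
    have "inf u' ?t = inf u' (sup s ?m)"
      using that(5) by (metis inf.absorb1 inf.assoc inf.commute)
    then show "inf u' ?t = z" using e that(1) by (simp add: oplus_def inf.commute)
    have "sup u' ?t = inf (sup x' y') (sup (sup s ?m) u')"
      using modular_law[of u' "sup x' y'" "sup s ?m"] that(5) by (simp add: ac_simps)
    also have "sup (sup s ?m) u' = sup u s" using le(4) by (simp add: ac_simps)
    also have "inf (sup x' y') (sup u s) = sup x' y'"
    proof (rule inf.absorb1)
      show "sup x' y' \<le> sup u s"
        using oplus_le(2)[OF assms(2)] oplus_le(2)[OF assms(3)] that(4) by (auto intro: le_supI1 le_supI2)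
    qed
    finally show "sup u' ?t = sup x' y'" .
  qed
  from key[OF assms(2)] key[OF assms(3)] s show ?thesis
    by (intro perspI[of _ ?t]) simp_all
qed

lemma indep_complements:
  fixes x y :: "'a::modular_lattice"
  assumes "oplus w z x' x" "oplus w z y' y" "inf x y = z"
  shows "inf x' y' = w" "inf z (sup x' y') = w"
proof -
  have "inf x y' = w"
    using assms oplus_le(2)[OF assms(2)] by (metis inf.absorb_iff2 inf.assoc oplus_def)
  then show "inf z (sup x' y') = w" using assms indep_shift by (metis oplus_def)
  show "inf x' y' = w"
    using \<open>inf x y' = w\<close> by (rule disjoint_mono) (use oplus_le[OF assms(1)] oplus_le[OF assms(2)] in simp_all)
qed

text \<open>
  The zero may be replaced by a smaller one, as long as the elements are disjoint. This makes up for
  a missing least element.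
\<close>

lemma persp_lower_iff:
  fixes x y :: "'a::modular_lattice"
  assumes x: "oplus w z x' x" and y: "oplus w z y' y" and d: "inf x y = z"
  shows "persp w x' y' \<longleftrightarrow> persp z x y"
proof
  note i = indep_complements[OF x y d]
  note le = oplus_le[OF x] oplus_le[OF y]
  have xy: "x = sup x' z" "y = sup y' z" using x y by (auto simp: oplus_def ac_simps)
  show "persp z x y" if p: "persp w x' y'"
  proof -
    obtain s where s: "inf x' s = w" "inf y' s = w" "sup x' s = sup x' y'" "sup y' s = sup x' y'" "s \<le> sup x' y'"
      using persp_axis[OF p] .
    have key: "inf (sup u z) (sup s z) = z" if "u \<le> sup x' y'" "inf u s = w" "w \<le> u" for u
    proof -
      have "inf (sup x' y') (sup z u) = sup (inf (sup x' y') z) u" by (rule modular_law) (rule that)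
      also have "\<dots> = u" using i that by (simp add: inf.commute sup.absorb2)
      finally have "inf (sup u z) s = inf u s" using s(5) by (metis inf.absorb2 inf.assoc inf.commute sup.commute)
      moreover have "inf (sup u z) (sup s z) = sup (inf (sup u z) s) z" by (rule modular_law) simp
      ultimately show ?thesis using that le by (simp add: sup.absorb2)
    qed
    show ?thesis
    proof (rule perspI[of _ "sup s z"])
      show "inf x (sup s z) = z" "inf y (sup s z) = z" unfolding xy using key s le by simp_all
      show "sup x (sup s z) = sup y (sup s z)" unfolding xy using s by (metis sup.assoc sup.commute)
    qed
  qed
  show "persp w x' y'" if p: "persp z x y"
  proof -
    obtain s where s: "inf x s = z" "inf y s = z" "sup x s = sup x y" "sup y s = sup x y" "s \<le> sup x y"
      using persp_axis[OF p] .
    let ?s = "inf s (sup x' y')"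
    have key: "inf u' ?s = w \<and> sup u' ?s = sup x' y'"
      if "u' \<le> sup x' y'" "inf u s = z" "sup u s = sup x y" "oplus w z u' u" for u u'
    proof
      have "inf u' ?s = inf u' s" using that(1) by (simp add: inf.left_commute inf.commute inf.absorb1)
      also have "\<dots> = inf u' (inf u s)" using oplus_le(2)[OF that(4)] by (metis inf.absorb1 inf.assoc)
      also have "\<dots> = w" using that by (simp add: oplus_def inf.commute)
      finally show "inf u' ?s = w" .
      have "sup u' ?s = inf (sup x' y') (sup s u')"
        using modular_law[of u' "sup x' y'" s] that(1) by (simp add: ac_simps)
      also have "sup s u' = sup u s" using that disjoint_ge(2)[OF that(2)] by (metis oplus_def sup.absorb2 sup.assoc sup.commute)
      also have "inf (sup x' y') (sup u s) = sup x' y'"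
        using that(3) le by (intro inf.absorb1) (auto intro: le_supI1 le_supI2)
      finally show "sup u' ?s = sup x' y'" .
    qed
    show ?thesis using key[OF _ _ _ x] key[OF _ _ _ y] s by (intro perspI[of _ ?s]) simp_all
  qed
qed

section \<open>Piecewise relations\<close>

text \<open>
  \<open>pw z R\<close> is the closure of \<open>R\<close> under simultaneous sums over \<open>z\<close>. Two decompositions of one element
  need not have a common refinement in a modular lattice, so pieces are only ever cut further, never
  matched with the pieces of another decomposition.
\<close>

inductive pw :: "'a::lattice \<Rightarrow> ('a \<Rightarrow> 'a \<Rightarrow> bool) \<Rightarrow> 'a \<Rightarrow> 'a \<Rightarrow> bool" for z R where
  pw_base: "R x y \<Longrightarrow> pw z R x y"
| pw_sum: "pw z R x1 y1 \<Longrightarrow> pw z R x2 y2 \<Longrightarrow> oplus z x1 x2 x \<Longrightarrow> oplus z y1 y2 y \<Longrightarrow> pw z R x y"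

lemma pw_bind:
  assumes "pw z R x y" "\<And>u v. R u v \<Longrightarrow> u \<le> x \<Longrightarrow> v \<le> y \<Longrightarrow> pw z S u v"
  shows "pw z S x y"
  using assms
proof (induction rule: pw.induct)
  case (pw_base x y) then show ?case by simp
next
  case (pw_sum x1 y1 x2 y2 x y)
  note le = oplus_le[OF pw_sum.hyps(3)] oplus_le[OF pw_sum.hyps(4)]
  have "pw z S x1 y1" "pw z S x2 y2"
    by (rule pw_sum.IH, rule pw_sum.prems; use le in force)+
  then show ?case using pw.pw_sum[OF _ _ pw_sum.hyps(3,4)] by blast
qed

lemma pw_sym:
  assumes "pw z R x y" "\<And>u v. R u v \<Longrightarrow> S v u" shows "pw z S y x"
  using assms by (induction rule: pw.induct) (auto intro: pw.intros)

text \<open>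
  Decompositions are pulled back from right to left. A chain of perspectivities has this property,
  hence cutting its last element cuts the whole chain.
\<close>

definition splitting :: "'a::lattice \<Rightarrow> ('a \<Rightarrow> 'a \<Rightarrow> bool) \<Rightarrow> bool" where
  "splitting z R \<longleftrightarrow> (\<forall>x y y1 y2. R x y \<longrightarrow> oplus z y1 y2 y \<longrightarrow>
     (\<exists>x1 x2. oplus z x1 x2 x \<and> R x1 y1 \<and> R x2 y2))"

lemma splittingD:
  assumes "splitting z R" "R x y" "oplus z y1 y2 y"
  obtains x1 x2 where "oplus z x1 x2 x" "R x1 y1" "R x2 y2"
  using assms unfolding splitting_def by blast

lemma splitting_persp: "splitting z (persp z :: 'a::modular_lattice \<Rightarrow> _)"
  unfolding splitting_def by (metis persp_split persp_sym)

lemma splitting_comp: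
  assumes "splitting z R" "splitting z S" shows "splitting z (R OO S)"
  unfolding splitting_def
proof (intro allI impI)
  fix x y y1 y2 assume "(R OO S) x y" and y: "oplus z y1 y2 y"
  then obtain w where w: "R x w" "S w y" by blast
  obtain w1 w2 where "oplus z w1 w2 w" "S w1 y1" "S w2 y2" using splittingD[OF assms(2) w(2) y] .
  moreover from this(1) obtain x1 x2 where "oplus z x1 x2 x" "R x1 w1" "R x2 w2" using splittingD[OF assms(1) w(1)] by blast
  ultimately show "\<exists>x1 x2. oplus z x1 x2 x \<and> (R OO S) x1 y1 \<and> (R OO S) x2 y2" by blast
qed

lemma splitting_tranclp:
  assumes "splitting z R" shows "splitting z R\<^sup>+\<^sup>+"
proof -
  have "\<exists>x1 x2. oplus z x1 x2 x \<and> R\<^sup>+\<^sup>+ x1 y1 \<and> R\<^sup>+\<^sup>+ x2 y2" if "R\<^sup>+\<^sup>+ x y" "oplus z y1 y2 y" for x y y1 y2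
    using that
  proof (induction arbitrary: y1 y2 rule: tranclp_induct)
    case (base y)
    show ?case by (rule splittingD[OF assms base]) blast
  next
    case (step y w)
    obtain v1 v2 where v: "oplus z v1 v2 y" "R v1 y1" "R v2 y2" using splittingD[OF assms step.hyps(2) step.prems] .
    from step.IH[OF v(1)] v(2,3) show ?case by (blast intro: tranclp.trancl_into_trancl)
  qed
  then show ?thesis by (auto simp: splitting_def)
qed

lemma splitting_conj:
  assumes "splitting z R" "\<And>x y x' y'. S x y \<Longrightarrow> x' \<le> x \<Longrightarrow> y' \<le> y \<Longrightarrow> z \<le> x' \<Longrightarrow> z \<le> y' \<Longrightarrow> S x' y'"
  shows "splitting z (\<lambda>x y. R x y \<and> S x y)"
  unfolding splitting_def
proof (intro allI impI)
  fix x y y1 y2 assume xy: "R x y \<and> S x y" and y: "oplus z y1 y2 y"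
  then obtain x1 x2 where x: "oplus z x1 x2 x" "R x1 y1" "R x2 y2" using splittingD[OF assms(1)] by blast
  show "\<exists>x1 x2. oplus z x1 x2 x \<and> (R x1 y1 \<and> S x1 y1) \<and> R x2 y2 \<and> S x2 y2"
    using x assms(2)[of x y] xy oplus_le[OF x(1)] oplus_le[OF y] by blast
qed

lemma pw_by_splitting:
  fixes x y :: "'a::relatively_complemented_lattice"
  assumes "splitting z R" "R x y" "z \<le> y" "z \<le> e"
    and "\<And>x y. R x y \<Longrightarrow> y \<le> e \<Longrightarrow> pw z Q x y"
    and "\<And>x y. R x y \<Longrightarrow> inf y e = z \<Longrightarrow> pw z Q x y"
  shows "pw z Q x y"
proof -
  obtain v where v: "oplus z (inf y e) v y" "inf v e = z" using split_by assms by metis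
  then obtain x1 x2 where x: "oplus z x1 x2 x" "R x1 (inf y e)" "R x2 v" using assms splittingD by metis
  show ?thesis using pw_sum[OF assms(5)[OF x(2) inf.cobounded2] assms(6)[OF x(3) v(2)] x(1) v(1)] .
qed

lemma pw_persp:
  fixes x y :: "'a::modular_lattice"
  assumes "pw z R x y" "persp z y w" shows "pw z (R OO persp z) x w"
  using assms
proof (induction arbitrary: w rule: pw.induct)
  case (pw_base x y) then show ?case by (auto intro: pw.pw_base)
next
  case (pw_sum x1 y1 x2 y2 x y)
  obtain w1 w2 where "oplus z w1 w2 w" "persp z y1 w1" "persp z y2 w2"
    using persp_split[OF pw_sum.prems pw_sum.hyps(4)] .
  then show ?case using pw.pw_sum[OF _ _ pw_sum.hyps(3)] pw_sum.IH by blast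
qed

text \<open>
  Axes of independent pieces can be joined, so for disjoint elements pieces need not be mentioned.
\<close>

lemma pw_persp_disjoint:
  fixes x y :: "'a::modular_lattice"
  assumes "pw z (persp z) x y" "inf x y = z" shows "persp z x y"
  using assms
proof (induction rule: pw.induct)
  case (pw_sum x1 y1 x2 y2 x y)
  have "inf x1 y1 = z" "inf x2 y2 = z"
    by (rule disjoint_mono[OF pw_sum.prems]; use oplus_le[OF pw_sum.hyps(3)] oplus_le[OF pw_sum.hyps(4)] in simp)+
  then show ?case using persp_oplus[OF pw_sum.hyps(3,4) pw_sum.prems] pw_sum.IH by blast
qed

section \<open>Projectivity by decomposition\<close>

text \<open>
  Projectivity by decomposition, over the zero \<open>z\<close>.
\<close>

definition appr :: "'a::lattice \<Rightarrow> 'a \<Rightarrow> 'a \<Rightarrow> bool" where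
  "appr z = pw z (persp z)\<^sup>+\<^sup>+"

lemma persp_imp_appr: "persp z x y \<Longrightarrow> appr z x y"
  by (simp add: appr_def pw_base tranclp.r_into_trancl)

lemma appr_refl: "z \<le> x \<Longrightarrow> appr z x x"
  by (intro persp_imp_appr persp_refl)

lemma appr_sum: "appr z x1 y1 \<Longrightarrow> appr z x2 y2 \<Longrightarrow> oplus z x1 x2 x \<Longrightarrow> oplus z y1 y2 y \<Longrightarrow> appr z x y"
  unfolding appr_def by (rule pw_sum)

lemma appr_persp_trans:
  fixes x y :: "'a::modular_lattice"
  assumes "appr z x y" "persp z y w" shows "appr z x w"
  using pw_persp[OF assms[unfolded appr_def]] unfolding appr_def
  by (rule pw_bind) (auto intro: pw_base tranclp.trancl_into_trancl)

lemma chain_sym: "(persp z)\<^sup>+\<^sup>+ x y \<Longrightarrow> (persp z)\<^sup>+\<^sup>+ y x"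
  by (induction rule: tranclp_induct) (auto intro: persp_sym tranclp_into_tranclp2)

lemma appr_sym: "appr z x y \<Longrightarrow> appr z y x"
  unfolding appr_def by (rule pw_sym[where R = "(persp z)\<^sup>+\<^sup>+"]) (auto intro: chain_sym)

text \<open>
  Induction on the decomposition \<open>y = y\<^sub>a \<oplus> y\<^sub>b\<close> that witnesses the relation. Given a second
  decomposition \<open>y = y\<^sub>1 \<oplus> y\<^sub>2\<close>, choose \<open>c = y\<^sub>a \<and> y\<^sub>1\<close>, \<open>y\<^sub>a = c \<oplus> d\<close>, \<open>y\<^sub>1 = c \<oplus> e\<close> and
  \<open>y = (y\<^sub>a \<or> y\<^sub>1) \<oplus> f\<close>. Then \<open>y\<^sub>b\<close> and \<open>e \<oplus> f\<close> are complements of \<open>y\<^sub>a\<close>, and \<open>y\<^sub>2\<close> and \<open>d \<oplus> f\<close> are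
  complements of \<open>y\<^sub>1\<close>. So the two decompositions have refinements that agree up to perspectivity.
  This is the Schreier refinement theorem for two chains of length two.
\<close>

lemma splitting_appr:
  "splitting z (appr z :: 'a::{modular_lattice, relatively_complemented_lattice} \<Rightarrow> _)"
  unfolding splitting_def
proof (intro allI impI)
  fix x y y1 y2 :: 'a
  assume "appr z x y" "oplus z y1 y2 y"
  then show "\<exists>x1 x2. oplus z x1 x2 x \<and> appr z x1 y1 \<and> appr z x2 y2"
    unfolding appr_def[of z, THEN fun_cong, of x]
  proof (induction arbitrary: y1 y2 rule: pw.induct)
    case (pw_base x y)
    obtain x1 x2 where "oplus z x1 x2 x" "(persp z)\<^sup>+\<^sup>+ x1 y1" "(persp z)\<^sup>+\<^sup>+ x2 y2"
      using splittingD[OF splitting_tranclp[OF splitting_persp] pw_base] .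
    then show ?case unfolding appr_def by (blast intro: pw.pw_base)
  next
    case (pw_sum xa ya xb yb x y)
    note y = \<open>oplus z ya yb y\<close> and y' = \<open>oplus z y1 y2 y\<close>
    have le: "z \<le> ya" "z \<le> y1" "ya \<le> y" "y1 \<le> y" using oplus_le[OF y] oplus_le[OF y'] by auto
    then have c: "z \<le> inf ya y1" by simp
    obtain d where d: "oplus z (inf ya y1) d ya" using c sectional_complement_exists by (metis inf.cobounded1)
    obtain e where e: "oplus z (inf ya y1) e y1" using c sectional_complement_exists by (metis inf.cobounded2)
    have s: "z \<le> sup ya y1" "sup ya y1 \<le> y" using le by (auto intro: le_supI1)
    obtain f where f: "oplus z (sup ya y1) f y" using sectional_complement_exists[OF s] .
    have ae: "oplus z ya e (sup ya y1)"
      using d e unfolding oplus_def by (metis inf.assoc inf.absorb2 inf.commute sup.assoc sup.cobounded2 sup_inf_absorb sup.commute)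
    have ad: "oplus z y1 d (sup ya y1)"
      using d e unfolding oplus_def by (metis inf.assoc inf.absorb2 inf.commute sup.assoc sup.cobounded2 sup_inf_absorb sup.commute)
    have ef: "oplus z e f (sup e f)" "oplus z ya (sup e f) y" using oplus_assoc[OF ae f] .
    have df: "oplus z d f (sup d f)" "oplus z y1 (sup d f) y" using oplus_assoc[OF ad f] .
    have "persp z (sup e f) yb" using persp_complements ef(2) y by metis
    then obtain ybe ybf where yb: "oplus z ybe ybf yb" "persp z e ybe" "persp z f ybf"
      using persp_split ef(1) by metis
    have dfy: "persp z (sup d f) y2" using persp_complements df(2) y' by metis
    obtain xc xd where xa: "oplus z xc xd xa" "appr z xc (inf ya y1)" "appr z xd d"
      using pw_sum.IH(1)[OF d] by auto
    obtain xe xf where xb: "oplus z xe xf xb" "appr z xe ybe" "appr z xf ybf"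
      using pw_sum.IH(2)[OF yb(1)] by auto
    have "appr z xe e" "appr z xf f" using xb yb appr_persp_trans persp_sym by metis+
    moreover note ic = oplus_interchange[OF xa(1) xb(1) \<open>oplus z xa xb x\<close>]
    ultimately have "appr z (sup xc xe) y1" "appr z (sup xd xf) (sup d f)"
      using appr_sum[OF xa(2)] appr_sum[OF xa(3)] e df(1) by metis+
    then show ?case using ic(3) dfy appr_persp_trans by metis
  qed
qed

lemma appr_trans:
  fixes x y w :: "'a::{modular_lattice, relatively_complemented_lattice}"
  assumes "appr z x y" "appr z y w" shows "appr z x w"
  using assms(2)[unfolded appr_def] assms(1)
proof (induction arbitrary: x rule: pw.induct)
  case (pw_base y w)
  then show ?case by (induction rule: tranclp_induct) (auto intro: appr_persp_trans)
next
  case (pw_sum y1 w1 y2 w2 y w)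
  then show ?case using splittingD[OF splitting_appr pw_sum.prems] by (metis appr_sum)
qed

lemma appr_le: assumes "appr z x y" shows "z \<le> x" "z \<le> y"
proof -
  have "z \<le> x \<and> z \<le> y" using assms[unfolded appr_def]
  proof (induction rule: pw.induct)
    case (pw_base x y) then show ?case by (metis persp_le tranclp.cases tranclpD)
  qed (auto dest: oplus_le)
  then show "z \<le> x" "z \<le> y" by auto
qed

lemma appr_zero: assumes "appr z x z" shows "x = z"
proof -
  have "y = z \<longrightarrow> x = z" if "pw z (persp z)\<^sup>+\<^sup>+ x y" for y using that
  proof (induction rule: pw.induct)
    case (pw_base x y) then show ?case by (induction rule: tranclp_induct) (auto dest: persp_zero)
  next
    case (pw_sum x1 y1 x2 y2 x y)
    then show ?case using oplus_le by (metis antisym oplus_def sup.idem)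
  qed
  then show ?thesis using assms by (auto simp: appr_def)
qed

section \<open>Equality and refinement in the dimension monoid\<close>

lemma Delta_oplus: "oplus z a b c \<Longrightarrow> Delta z c = Delta z a + Delta z b"
  using Delta_D1[of z a c] Delta_D2[of a b] oplus_le[of z a b c] by (auto simp: oplus_def)

lemma Delta_complement: "oplus z a u b \<Longrightarrow> Delta z u = Delta a b"
  using Delta_D2[of a u] by (auto simp: oplus_def)

lemma Delta_persp: "persp z x y \<Longrightarrow> Delta z x = Delta z y"
  unfolding persp_def by (metis Delta_D2 inf.commute sup.commute)

lemma Delta_appr: "appr z x y \<Longrightarrow> Delta z x = Delta z y"
  unfolding appr_def
proof (induction rule: pw.induct)
  case (pw_base x y)
  then show ?case by (induction rule: tranclp_induct) (auto dest: Delta_persp)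
next
  case (pw_sum x1 y1 x2 y2 x y)
  then show ?case by (simp add: Delta_oplus)
qed

lemma ivl_inject: "a \<le> b \<Longrightarrow> c \<le> d \<Longrightarrow> ivl a b = ivl c d \<longleftrightarrow> a = c \<and> b = d"
  unfolding ivl_def by (subst Abs_ivl_inject) auto

text \<open>
  The element \<open>x\<close> over the zero \<open>z\<close> represents the interval \<open>[a,b]\<close>, through a complement of \<open>a\<close> in
  \<open>b\<close> over \<open>z\<close>. All such complements are perspective.
\<close>

definition piece :: "'a::lattice \<Rightarrow> 'a \<Rightarrow> 'a ivl \<Rightarrow> bool" where
  "piece z x c \<longleftrightarrow> (\<exists>a b u. c = ivl a b \<and> oplus z a u b \<and> appr z x u)"

text \<open>
  The element is a sum of pieces, one for each interval of the multiset. This is the invariant of the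
  congruence that defines the dimension monoid.
\<close>

inductive rep :: "'a::lattice \<Rightarrow> 'a \<Rightarrow> 'a ivl multiset \<Rightarrow> bool" for z where
  rep_empty: "rep z z {#}"
| rep_add: "rep z x A \<Longrightarrow> piece z u c \<Longrightarrow> oplus z x u y \<Longrightarrow> rep z y (add_mset c A)"

inductive_cases rep_emptyE: "rep z x {#}"

lemma rep_ge: "rep z x A \<Longrightarrow> z \<le> x"
  by (induction rule: rep.induct) (auto dest: oplus_le)

lemma piece_ivl:
  fixes a b x :: "'a::{modular_lattice, relatively_complemented_lattice}"
  assumes "oplus z a u b" shows "piece z x (ivl a b) \<longleftrightarrow> appr z x u"
proof
  assume "piece z x (ivl a b)"
  then obtain a' b' u' where c: "ivl a b = ivl a' b'" "oplus z a' u' b'" "appr z x u'"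
    by (auto simp: piece_def)
  then have "a' = a" "b' = b" using ivl_inject oplus_le(1) assms by metis+
  then have "persp z u' u" using c assms persp_complements by blast
  then show "appr z x u" using c appr_persp_trans by blast
qed (use assms in \<open>auto simp: piece_def\<close>)

lemma piece_sum:
  fixes a b c x :: "'a::{modular_lattice, relatively_complemented_lattice}"
  assumes "z \<le> a" "a \<le> b" "b \<le> c"
  shows "piece z x (ivl a c) \<longleftrightarrow> (\<exists>x1 x2. piece z x1 (ivl a b) \<and> piece z x2 (ivl b c) \<and> oplus z x1 x2 x)"
proof -
  obtain u where u: "oplus z a u b" using sectional_complement_exists[OF assms(1,2)] .
  obtain v where v: "oplus z b v c" using sectional_complement_exists[OF _ assms(3)] assms by (metis order_trans)
  have uv: "oplus z u v (sup u v)" "oplus z a (sup u v) c" using oplus_assoc[OF u v] .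
  have "appr z x (sup u v) \<longleftrightarrow> (\<exists>x1 x2. appr z x1 u \<and> appr z x2 v \<and> oplus z x1 x2 x)"
    using splittingD[OF splitting_appr _ uv(1)] appr_sum[OF _ _ _ uv(1)] by metis
  then show ?thesis by (simp add: piece_ivl[OF u] piece_ivl[OF v] piece_ivl[OF uv(2)])
qed

lemma rep_add_msetE:
  fixes x :: "'a::modular_lattice"
  assumes "rep z x (add_mset c A)"
  shows "\<exists>y u. rep z y A \<and> piece z u c \<and> oplus z y u x"
  using assms
proof (induction x "add_mset c A" arbitrary: A rule: rep.induct)
  case (rep_add x B u d y)
  show ?case
  proof (cases "c = d")
    case True
    then show ?thesis using rep_add by auto
  next
    case False
    then obtain C where C: "B = add_mset c C" "A = add_mset d C"
      using rep_add.hyps by (metis add_eq_conv_ex)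
    then obtain x' v where x': "rep z x' C" "piece z v c" "oplus z x' v x" using rep_add.hyps by blast
    have o: "oplus z u x' (sup u x')" "oplus z v (sup u x') y"
      using oplus_assoc[of z v x' x u y] x'(3) rep_add.hyps(4) by (simp_all add: oplus_commute sup.commute)
    have "rep z (sup u x') A" unfolding C using rep.rep_add[OF x'(1) rep_add.hyps(3)] o(1) oplus_commute by blast
    then show ?thesis using x' o(2) oplus_commute by blast
  qed
qed simp

lemma rep_add_mset:
  fixes x :: "'a::modular_lattice"
  shows "rep z x (add_mset c A) \<longleftrightarrow> (\<exists>y u. rep z y A \<and> piece z u c \<and> oplus z y u x)"
  using rep_add_msetE rep_add by metis

lemma piece_ge: "piece z x c \<Longrightarrow> z \<le> x"
  by (auto simp: piece_def dest: appr_le)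

lemma rep_single:
  fixes x :: "'a::modular_lattice"
  shows "rep z x {#c#} \<longleftrightarrow> piece z x c"
  unfolding rep_add_mset
proof
  assume "\<exists>y u. rep z y {#} \<and> piece z u c \<and> oplus z y u x"
  then obtain u where "piece z u c" "oplus z z u x" by (auto elim: rep_emptyE)
  moreover then have "u = x" by (simp add: oplus_def sup.absorb2 piece_ge)
  ultimately show "piece z x c" by simp
next
  assume "piece z x c"
  then show "\<exists>y u. rep z y {#} \<and> piece z u c \<and> oplus z y u x"
    using rep_empty oplus_zero(1) piece_ge by metis
qed

lemma rep_union:
  fixes x :: "'a::modular_lattice"
  shows "rep z x (A + B) \<longleftrightarrow> (\<exists>y w. rep z y A \<and> rep z w B \<and> oplus z y w x)"
proof (induction B arbitrary: x)
  case empty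
  show ?case
  proof
    assume "rep z x (A + {#})"
    then show "\<exists>y w. rep z y A \<and> rep z w {#} \<and> oplus z y w x"
      using rep_empty[of z] rep_ge[of z x A] oplus_zero(2)[of z x] by auto
  next
    assume "\<exists>y w. rep z y A \<and> rep z w {#} \<and> oplus z y w x"
    then obtain y where y: "rep z y A" "oplus z y z x" by (auto elim: rep_emptyE)
    then have "y = x" by (simp add: oplus_def sup.absorb1 rep_ge)
    then show "rep z x (A + {#})" using y by simp
  qed
next
  case (add c B)
  have "rep z x (A + add_mset c B) \<longleftrightarrow> (\<exists>v u. (\<exists>y w. rep z y A \<and> rep z w B \<and> oplus z y w v) \<and> piece z u c \<and> oplus z v u x)"
    by (simp add: rep_add_mset add)
  also have "\<dots> \<longleftrightarrow> (\<exists>y v. rep z y A \<and> (\<exists>w u. rep z w B \<and> piece z u c \<and> oplus z w u v) \<and> oplus z y v x)"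
  proof
    assume "\<exists>v u. (\<exists>y w. rep z y A \<and> rep z w B \<and> oplus z y w v) \<and> piece z u c \<and> oplus z v u x"
    then show "\<exists>y v. rep z y A \<and> (\<exists>w u. rep z w B \<and> piece z u c \<and> oplus z w u v) \<and> oplus z y v x"
      using oplus_assoc by blast
  next
    assume "\<exists>y v. rep z y A \<and> (\<exists>w u. rep z w B \<and> piece z u c \<and> oplus z w u v) \<and> oplus z y v x"
    then obtain y v w u where *: "rep z y A" "rep z w B" "piece z u c" "oplus z w u v" "oplus z y v x" by blast
    have "oplus z w y (sup w y)" "oplus z u (sup w y) x"
      using oplus_assoc[of z u w v y x] * by (simp_all add: oplus_commute)
    then show "\<exists>v u. (\<exists>y w. rep z y A \<and> rep z w B \<and> oplus z y w v) \<and> piece z u c \<and> oplus z v u x"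
      using * oplus_commute by blast
  qed
  also have "\<dots> \<longleftrightarrow> (\<exists>y v. rep z y A \<and> rep z v (add_mset c B) \<and> oplus z y v x)"
    by (simp add: rep_add_mset)
  finally show ?case .
qed

lemma Delta_rep: "rep z x A \<Longrightarrow> Delta z x = abs_Dim A"
proof (induction rule: rep.induct)
  case rep_empty
  then show ?case by (simp add: Delta_D0 zero_Dim_def)
next
  case (rep_add x A u c y)
  then obtain a b v where c: "c = ivl a b" "oplus z a v b" "appr z u v" by (auto simp: piece_def)
  have "Delta z u = abs_Dim {#c#}"
    using c Delta_appr Delta_complement by (metis Delta.abs_eq)
  then show ?case using Delta_oplus[OF rep_add.hyps(3)] rep_add.IH by (simp add: plus_Dim.abs_eq)
qed

text \<open>
  Each defining relation holds for the elements over any zero that lies below the intervals involved: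
  (D1) because pieces can be split and summed, (D2) because a complement of \<open>a \<and> b\<close> in \<open>b\<close> is also a
  complement of \<open>a\<close> in \<open>a \<or> b\<close>. The bound \<open>w\<close> collects the finitely many intervals of a derivation.
\<close>

lemma dim_cong_rep:
  fixes A B :: "'a::{modular_lattice, relatively_complemented_lattice} ivl multiset"
  assumes "dim_cong A B"
  shows "\<exists>w. \<forall>z\<le>w. \<forall>x. rep z x A \<longleftrightarrow> rep z x B"
  using assms
proof (induction rule: dim_cong.induct)
  case (trans A B C)
  then obtain w1 w2 where "\<forall>z\<le>w1. \<forall>x. rep z x A \<longleftrightarrow> rep z x B" "\<forall>z\<le>w2. \<forall>x. rep z x B \<longleftrightarrow> rep z x C" by blast
  then show ?case by (intro exI[of _ "inf w1 w2"]) simp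
next
  case (add A B C D)
  then obtain w1 w2 where "\<forall>z\<le>w1. \<forall>x. rep z x A \<longleftrightarrow> rep z x B" "\<forall>z\<le>w2. \<forall>x. rep z x C \<longleftrightarrow> rep z x D" by blast
  then show ?case by (intro exI[of _ "inf w1 w2"]) (simp add: rep_union)
next
  case (D0 a)
  have "rep z x {#ivl a a#} \<longleftrightarrow> rep z x {#}" if "z \<le> a" for z x
  proof -
    have "piece z x (ivl a a) \<longleftrightarrow> appr z x z" using piece_ivl oplus_zero(2) that by blast
    also have "\<dots> \<longleftrightarrow> x = z" using appr_zero persp_imp_appr persp_refl by blast
    also have "\<dots> \<longleftrightarrow> rep z x {#}" by (auto intro: rep_empty elim: rep_emptyE)
    finally show ?thesis by (simp add: rep_single)
  qed
  then show ?case by blast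
next
  case (D1 a b c)
  show ?case
    by (intro exI[of _ a] allI impI, unfold rep_union rep_single, rule piece_sum[OF _ D1])
next
  case (D2 a b)
  have "piece z x (ivl a (sup a b)) \<longleftrightarrow> piece z x (ivl (inf a b) b)" if h: "z \<le> inf a b" for z x
  proof -
    obtain u where u: "oplus z (inf a b) u b" using sectional_complement_exists[OF h inf.cobounded2] .
    have "inf a u = inf (inf a b) u" using oplus_le(2)[OF u] by (metis inf.absorb2 inf.assoc)
    moreover have "sup a u = sup a b" using u by (metis oplus_def sup.assoc sup_inf_absorb)
    ultimately have "oplus z a u (sup a b)" using u by (simp add: oplus_def)
    then show ?thesis using piece_ivl u by blast
  qed
  then show ?case unfolding rep_single by blast
qed blast+

text \<open>
  The converse of \<open>Delta_appr\<close>, at the price of a smaller zero.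
\<close>

lemma Delta_eq_imp_appr:
  fixes x y :: "'a::{modular_lattice, relatively_complemented_lattice}"
  assumes "Delta z x = Delta z' y" "z \<le> x" "z' \<le> y"
  shows "\<exists>w. \<forall>v\<le>w. \<forall>x' y'. oplus v z x' x \<longrightarrow> oplus v z' y' y \<longrightarrow> appr v x' y'"
proof -
  have "dim_cong {#ivl z x#} {#ivl z' y#}"
    using assms(1) by (simp add: Delta.abs_eq Dim.abs_eq_iff)
  then obtain w where w: "\<And>v u. v \<le> w \<Longrightarrow> rep v u {#ivl z x#} \<longleftrightarrow> rep v u {#ivl z' y#}"
    using dim_cong_rep by blast
  have "appr v x' y'" if "v \<le> w" "oplus v z x' x" "oplus v z' y' y" for v x' y'
  proof -
    have "piece v x' (ivl z x)" using piece_ivl[OF that(2)] appr_refl[OF oplus_le(4)[OF that(2)]] by simp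
    then show ?thesis using w[OF that(1)] piece_ivl[OF that(3)] by (simp add: rep_single)
  qed
  then show ?thesis by blast
qed

text \<open>
  The decomposition is found over a smaller zero, as the element represents both sides there, and
  then joined with \<open>z\<close>.
\<close>

lemma Delta_eq_sum_refine:
  fixes x :: "'a::{modular_lattice, relatively_complemented_lattice}"
  assumes "Delta z x = \<alpha> + \<beta>" "z \<le> x"
  obtains x1 x2 where "oplus z x1 x2 x" "Delta z x1 = \<alpha>" "Delta z x2 = \<beta>"
proof -
  obtain A B where AB: "\<alpha> = abs_Dim A" "\<beta> = abs_Dim B" using Quotient3_abs_rep[OF Quotient3_Dim] that by metis
  then have "dim_cong {#ivl z x#} (A + B)"
    using assms(1) by (simp add: Delta.abs_eq Dim.abs_eq_iff plus_Dim.abs_eq)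
  then obtain w where w: "\<And>v u. v \<le> w \<Longrightarrow> rep v u {#ivl z x#} \<longleftrightarrow> rep v u (A + B)"
    using dim_cong_rep by blast
  let ?v = "inf w z"
  obtain x' where x': "oplus ?v z x' x" using sectional_complement_exists[OF inf.cobounded2 assms(2)] .
  then have "rep ?v x' {#ivl z x#}"
    using piece_ivl[OF x'] appr_refl[OF oplus_le(4)[OF x']] by (simp add: rep_single)
  then obtain y1 y2 where y: "rep ?v y1 A" "rep ?v y2 B" "oplus ?v y1 y2 x'"
    using w[of ?v] by (auto simp: rep_union)
  have o: "oplus ?v z y1 (sup y1 z)" "oplus ?v z y2 (sup y2 z)"
    using disjoint_mono[of z x' ?v z y1] disjoint_mono[of z x' ?v z y2] x' oplus_le[OF y(3)] by (simp_all add: oplus_def sup.commute)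
  show ?thesis
  proof
    show "Delta z (sup y1 z) = \<alpha>" using Delta_complement[OF o(1)] Delta_rep[OF y(1)] AB by simp
    show "Delta z (sup y2 z) = \<beta>" using Delta_complement[OF o(2)] Delta_rep[OF y(2)] AB by simp
    have "inf y1 y2 = ?v" "inf (sup y1 y2) z = ?v" using y(3) x' by (auto simp: oplus_def inf.commute)
    then have "inf y1 (sup y2 z) = ?v" using indep_shift by blast
    then have "inf (sup y2 z) (sup y1 z) = sup ?v z" using modular_law[of z "sup y2 z" y1] by (simp add: inf.commute)
    moreover have "sup (sup y1 z) (sup y2 z) = x"
      using y(3) x' unfolding oplus_def by (metis sup.assoc sup.commute sup.left_idem)
    ultimately show "oplus z (sup y1 z) (sup y2 z) x" by (simp add: oplus_def sup.absorb2 inf.commute)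
  qed
qed

section \<open>Three independent copies\<close>

text \<open>
  Triples are indexed by \<open>0, 1, 2\<close>, since the arguments below treat two arbitrary ones of the three
  elements alike.
\<close>

definition indep3 :: "'a::lattice \<Rightarrow> (nat \<Rightarrow> 'a) \<Rightarrow> bool" where
  "indep3 z P \<longleftrightarrow> (\<forall>i<3. \<forall>j<3. \<forall>k<3. i \<noteq> j \<longrightarrow> i \<noteq> k \<longrightarrow> j \<noteq> k \<longrightarrow> inf (P i) (sup (P j) (P k)) = z)"

definition copies :: "'a::lattice \<Rightarrow> (nat \<Rightarrow> 'a) \<Rightarrow> (nat \<Rightarrow> 'a) \<Rightarrow> bool" where
  "copies z P q \<longleftrightarrow> (\<forall>k<3. q k \<le> P k \<and> (\<forall>j<3. persp z (q j) (q k)))"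

definition triplicated :: "'a::lattice \<Rightarrow> 'a \<Rightarrow> bool" where
  "triplicated z p \<longleftrightarrow> (\<exists>P. indep3 z P \<and> copies z P P \<and> P 0 = p)"

lemma copiesD:
  assumes "copies z P q" "k < 3"
  shows "q k \<le> P k" "z \<le> q k" "z \<le> P k" "j < 3 \<Longrightarrow> persp z (q j) (q k)"
  using assms persp_le(1) unfolding copies_def by (blast intro: order_trans)+

lemma third_index:
  assumes "i < (3::nat)" "j < 3" "i \<noteq> j" obtains k where "k < 3" "k \<noteq> i" "k \<noteq> j"
proof -
  have "\<exists>k<3. k \<noteq> i \<and> k \<noteq> j" using assms by presburger
  then show ?thesis using that by blast
qed

lemma indep3_pair:
  assumes "indep3 z P" "copies z P q" "i < 3" "j < 3" "i \<noteq> j"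
  shows "inf (P i) (P j) = z"
proof -
  obtain k where k: "k < 3" "k \<noteq> i" "k \<noteq> j" using third_index assms(3-5) .
  then have "inf (P i) (sup (P j) (P k)) = z" using assms(1,3-5) unfolding indep3_def by metis
  then show ?thesis
    by (rule disjoint_mono) (use copiesD(3)[OF assms(2)] assms(3,4) in auto)
qed

text \<open>
  Perspectivity to one member of an independent triple is enough, by \<open>persp_trans\<close>.
\<close>

lemma copies_star:
  fixes P :: "nat \<Rightarrow> 'a::modular_lattice"
  assumes P: "indep3 z P" and i: "i < 3" and q: "\<And>k. k < 3 \<Longrightarrow> q k \<le> P k \<and> persp z (q i) (q k)"
  shows "copies z P q"
  unfolding copies_def
proof (intro allI impI conjI)
  fix k j :: nat assume k: "k < 3" and j: "j < 3"
  show "q k \<le> P k" using q k by simp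
  have le: "z \<le> q k" if "k < 3" for k using q[OF that] persp_le(2) by blast
  show "persp z (q j) (q k)"
  proof (cases "j = i \<or> k = i \<or> j = k")
    case True
    then show ?thesis using q[OF j] q[OF k] le[OF k] persp_sym persp_refl by metis
  next
    case False
    then have "inf (P j) (sup (P i) (P k)) = z" using P i j k unfolding indep3_def by metis
    then have "inf (q j) (sup (q i) (q k)) = z"
      by (rule disjoint_mono) (use q[OF i] q[OF j] q[OF k] le[OF i] le[OF j] in \<open>auto intro: le_supI1 le_supI2\<close>)
    then show ?thesis using persp_trans persp_sym q[OF j] q[OF k] by metis
  qed
qed

lemma copies_split:
  fixes P :: "nat \<Rightarrow> 'a::modular_lattice"
  assumes P: "indep3 z P" and q: "copies z P q" and i: "i < 3" and u: "oplus z u1 u2 (q i)"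
  obtains q1 q2 where "copies z P q1" "copies z P q2" "q1 i = u1" "q2 i = u2"
    "\<And>k. k < 3 \<Longrightarrow> oplus z (q1 k) (q2 k) (q k)"
proof -
  have "\<exists>a b. oplus z a b (q k) \<and> persp z u1 a \<and> persp z u2 b \<and> (k = i \<longrightarrow> a = u1 \<and> b = u2)" if k: "k < 3" for k
  proof (cases "k = i")
    case True
    then show ?thesis using u persp_refl oplus_le[OF u] by blast
  next
    case False
    then show ?thesis using persp_split[OF copiesD(4)[OF q k i] u] by metis
  qed
  then obtain q1 q2 where *: "\<And>k. k < 3 \<Longrightarrow> oplus z (q1 k) (q2 k) (q k) \<and> persp z u1 (q1 k) \<and> persp z u2 (q2 k) \<and>
      (k = i \<longrightarrow> q1 k = u1 \<and> q2 k = u2)"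
    by metis
  have "q1 k \<le> P k \<and> persp z (q1 i) (q1 k)" "q2 k \<le> P k \<and> persp z (q2 i) (q2 k)" if "k < 3" for k
    using *[OF that] *[OF i] oplus_le(1,2)[of z "q1 k" "q2 k" "q k"] copiesD(1)[OF q that] by (auto intro: order_trans)
  then have "copies z P q1" "copies z P q2" using copies_star[OF P i] by blast+
  then show ?thesis using that * i by blast
qed

lemma triplicatedI:
  fixes p :: "'a::modular_lattice"
  assumes d: "inf p p1 = z" "inf (sup p p1) p2 = z" and p: "persp z p p1" "persp z p p2"
  shows "triplicated z p"
proof -
  define P where "P = (\<lambda>k::nat. if k = 0 then p else if k = 1 then p1 else p2)"
  have a: "inf p (sup p1 p2) = z" using indep_shift d by blast
  have b: "inf p1 (sup p p2) = z" using indep_shift[of p1 p z p2] d by (simp add: inf.commute sup.commute)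
  have c: "inf p2 (sup p p1) = z" using d by (simp add: inf.commute)
  have P: "indep3 z P"
    unfolding indep3_def P_def using a b c by (auto simp: sup.commute less_Suc_eq numeral_3_eq_3)
  have "copies z P P"
    by (rule copies_star[OF P, of 0]) (use p persp_refl[OF persp_le(1)[OF p(1)]] in \<open>auto simp: P_def\<close>)
  then show ?thesis unfolding triplicated_def using P by (auto simp: P_def)
qed

lemma triplicatedE:
  fixes p :: "'a::modular_lattice"
  assumes "triplicated z p"
  obtains p1 p2 where "inf p p1 = z" "inf (sup p p1) p2 = z" "persp z p p1" "persp z p p2"
proof -
  obtain P where P: "indep3 z P" "copies z P P" "P 0 = p" using assms by (auto simp: triplicated_def)
  have "inf (P 2) (sup (P 0) (P 1)) = z" using P(1) by (simp add: indep3_def)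
  then show ?thesis
    using that[of "P 1" "P 2"] P indep3_pair[OF P(1,2), of 0 1] copiesD(4)[OF P(2), of _ 0] by (simp add: inf.commute)
qed

text \<open>
  Keeps track of the part \<open>p\<close> of \<open>P 0\<close> that corresponds to \<open>w\<close>, even if \<open>w\<close> is only known to be
  perspective to the copy of \<open>p\<close> in \<open>P i\<close>.
\<close>

definition copied :: "'a::lattice \<Rightarrow> (nat \<Rightarrow> 'a) \<Rightarrow> nat \<Rightarrow> 'a \<Rightarrow> 'a \<Rightarrow> bool" where
  "copied z P i p w \<longleftrightarrow> (\<exists>q. copies z P q \<and> q 0 = p \<and> persp z (q i) w)"

lemma splitting_copied:
  fixes P :: "nat \<Rightarrow> 'a::modular_lattice"
  assumes "indep3 z P" "i < 3" shows "splitting z (copied z P i)"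
  unfolding splitting_def
proof (intro allI impI)
  fix p w w1 w2 assume "copied z P i p w" and w: "oplus z w1 w2 w"
  then obtain q where q: "copies z P q" "q 0 = p" "persp z (q i) w" by (auto simp: copied_def)
  obtain u1 u2 where u: "oplus z u1 u2 (q i)" "persp z w1 u1" "persp z w2 u2"
    using persp_split[OF persp_sym[OF q(3)] w] .
  obtain q1 q2 where "copies z P q1" "copies z P q2" "q1 i = u1" "q2 i = u2" "oplus z (q1 0) (q2 0) (q 0)"
    using copies_split[OF assms(1) q(1) assms(2) u(1)] by (metis zero_less_numeral)
  then show "\<exists>x1 x2. oplus z x1 x2 p \<and> copied z P i x1 w1 \<and> copied z P i x2 w2"
    unfolding copied_def using u q(2) persp_sym by metis
qed

text \<open>
  The state in which a chain starting at \<open>p\<close> is kept: \<open>w\<close> is perspective to the copies of \<open>p\<close> in \<open>P i\<close>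
  and, by \<open>persp_trans\<close>, in \<open>P j\<close>, and it forms an independent triple with them.
\<close>

definition reach :: "'a::lattice \<Rightarrow> (nat \<Rightarrow> 'a) \<Rightarrow> 'a \<Rightarrow> 'a \<Rightarrow> bool" where
  "reach z P p w \<longleftrightarrow> (\<exists>i j. i < 3 \<and> j < 3 \<and> i \<noteq> j \<and> copied z P i p w \<and> inf w (sup (P i) (P j)) = z)"

lemma reachI:
  "copies z P q \<Longrightarrow> q 0 = p \<Longrightarrow> i < 3 \<Longrightarrow> j < 3 \<Longrightarrow> i \<noteq> j \<Longrightarrow> persp z w (q i) \<Longrightarrow>
    inf w (sup (P i) (P j)) = z \<Longrightarrow> reach z P p w"
  unfolding reach_def copied_def using persp_sym by blast

text \<open>
  Cut \<open>y\<close> by \<open>P i \<or> P j\<close>, then the inner part by \<open>P i\<close> and the outer part by \<open>w \<or> P i\<close>. In each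
  of the four resulting positions some two of the three copies are in such a position to \<open>y\<close> and its
  predecessor that \<open>persp_trans\<close> applies. The third index \<open>k\<close> is used if \<open>y\<close> lies inside
  \<open>P i \<or> P j\<close>.
\<close>

lemma reach_step:
  fixes P :: "nat \<Rightarrow> 'a::{modular_lattice, relatively_complemented_lattice}"
  assumes P: "indep3 z P" and r: "reach z P p w" and wy: "persp z w y"
  shows "pw z (reach z P) p y"
proof -
  obtain i j where ij: "i < 3" "j < 3" "i \<noteq> j" and cw: "copied z P i p w" and W: "inf w (sup (P i) (P j)) = z"
    using r by (auto simp: reach_def)
  obtain k where k: "k < 3" "k \<noteq> i" "k \<noteq> j" using third_index ij .
  define link where "link = copied z P i OO (\<lambda>v y. persp z v y \<and> v \<le> w)"
  have spl: "splitting z link"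
    unfolding link_def by (intro splitting_comp splitting_copied splitting_conj splitting_persp P ij) (auto intro: order_trans)
  have link: "link p y" unfolding link_def using cw wy by blast
  obtain q0 where q0: "copies z P q0" using cw by (auto simp: copied_def)
  have zP: "z \<le> P i" "z \<le> P j" "z \<le> P k" using copiesD(3)[OF q0] ij k by auto
  have zw: "z \<le> w" using wy persp_le by blast
  have Pij: "inf (P i) (P j) = z" using indep3_pair[OF P q0] ij by blast
  have jWi: "inf (P j) (sup w (P i)) = z"
    using indep_shift[of "P j" "P i" z w] Pij W by (simp add: inf.commute sup.commute)
  have basics: "\<exists>q v. copies z P q \<and> q 0 = p' \<and> v \<le> w \<and> persp z v (q i) \<and> persp z v (q j) \<and> persp z v y' \<and> z \<le> y' \<and> z \<le> v
      \<and> persp z (q i) (q j) \<and> persp z (q j) (q k) \<and> q i \<le> P i \<and> q j \<le> P j \<and> q k \<le> P k \<and> z \<le> q i \<and> z \<le> q j \<and> z \<le> q k"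
    if l: "link p' y'" for p' y'
  proof -
    obtain v where v: "copied z P i p' v" "persp z v y'" "v \<le> w" using l unfolding link_def by blast
    then obtain q where q: "copies z P q" "q 0 = p'" "persp z v (q i)" unfolding copied_def using persp_sym by blast
    have le: "z \<le> v" "z \<le> q i" "q i \<le> P i" "q j \<le> P j" using v q persp_le copiesD[OF q(1)] ij by blast+
    have "inf v (sup (q i) (q j)) = z"
      by (rule disjoint_mono[OF W]) (use v le in \<open>auto intro: le_supI1 le_supI2\<close>)
    then have "persp z v (q j)" using persp_trans q(3) copiesD(4)[OF q(1) ij(2,1)] by blast
    then show ?thesis using v q le copiesD[OF q(1)] ij k persp_le by blast
  qed
  have out_out: "reach z P p' y'" if l: "link p' y'" and d: "inf y' (sup w (P i)) = z" "inf y' (sup (P i) (P j)) = z" for p' y'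
  proof -
    obtain q v where q: "copies z P q" "q 0 = p'" "v \<le> w" "persp z v (q i)" "persp z v y'" "z \<le> y'" "q i \<le> P i" "z \<le> q i"
      using basics[OF l] by blast
    have "inf y' (sup v (q i)) = z"
      by (rule disjoint_mono[OF d(1)]) (use q in \<open>auto intro: le_supI1 le_supI2\<close>)
    then have "persp z y' (q i)" using persp_trans persp_sym q by blast
    then show ?thesis using reachI[OF q(1,2) ij] d by blast
  qed
  have near: "persp z y' (q j)"
    if "v \<le> w" "persp z v (q j)" "persp z v y'" "y' \<le> sup w (P i)" "q j \<le> P j" "z \<le> q j" "z \<le> v" for y' v q
  proof -
    have "inf (q j) (sup v y') = z"
      by (rule disjoint_mono[OF jWi]) (use that in \<open>auto intro: le_supI1 le_supI2\<close>)
    then show ?thesis using persp_trans persp_sym that by blast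
  qed
  have out_in: "reach z P p' y'" if l: "link p' y'" and d: "y' \<le> sup w (P i)" "inf y' (sup (P i) (P j)) = z" for p' y'
  proof -
    obtain q v where q: "copies z P q" "q 0 = p'" "v \<le> w" "persp z v (q j)" "persp z v y'" "q j \<le> P j" "z \<le> q j" "z \<le> v"
      using basics[OF l] by blast
    have "persp z y' (q j)" using near q d(1) by blast
    then show ?thesis using reachI[OF q(1,2) ij(2,1)] ij d by (simp add: sup.commute)
  qed
  have in_in: "reach z P p' y'" if l: "link p' y'" and d: "y' \<le> P i" for p' y'
  proof -
    obtain q v where q: "copies z P q" "q 0 = p'" "v \<le> w" "persp z v (q j)" "persp z v y'" "z \<le> y'" "q j \<le> P j" "z \<le> q j" "z \<le> v"
      using basics[OF l] by blast
    have "persp z y' (q j)" using near q d by (simp add: le_supI2)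
    moreover have "inf (P i) (sup (P j) (P k)) = z" using P ij k unfolding indep3_def by metis
    then have "inf y' (sup (P j) (P k)) = z"
      by (rule disjoint_mono) (use d q zP in \<open>auto intro: le_supI1\<close>)
    ultimately show ?thesis using reachI[OF q(1,2) ij(2) k(1)] k by metis
  qed
  have in_out: "reach z P p' y'" if l: "link p' y'" and d: "y' \<le> sup (P i) (P j)" "inf y' (P i) = z" for p' y'
  proof -
    obtain q v where q: "copies z P q" "q 0 = p'" "v \<le> w" "persp z v (q i)" "persp z v y'" "z \<le> y'" "q i \<le> P i" "z \<le> q i" "z \<le> v"
      using basics[OF l] by blast
    have "inf v (sup y' (q i)) = z"
      by (rule disjoint_mono[OF W]) (use q d in \<open>auto intro: le_supI1 le_supI2\<close>)
    moreover have "inf y' (q i) = z" by (rule disjoint_mono[OF d(2)]) (use q in auto)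
    ultimately have "persp z y' (q i)" using persp_trans_middle q by blast
    moreover have "inf y' (sup (P i) (P k)) = z"
    proof -
      have "inf (P k) (sup (P i) (P j)) = z" using P ij k unfolding indep3_def by metis
      then have "inf (sup (P i) (P j)) (sup (P k) (P i)) = P i"
        using modular_law[of "P i" "sup (P i) (P j)" "P k"] zP by (simp add: inf.commute sup.absorb2)
      then have "inf y' (sup (P i) (P k)) = inf y' (P i)" using d(1) by (metis inf.absorb1 inf.assoc sup.commute)
      then show ?thesis using d by simp
    qed
    ultimately show ?thesis using reachI[OF q(1,2) ij(1) k(1)] k by metis
  qed
  have zy: "z \<le> y'" if "link p' y'" for p' y' using basics[OF that] by blast
  have sl: "splitting z (\<lambda>a b. link a b \<and> b \<le> e)" "splitting z (\<lambda>a b. link a b \<and> inf b e = z)" for e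
    by (rule splitting_conj[OF spl], metis order_trans)
      (rule splitting_conj[OF spl], metis disjoint_mono disjoint_ge(2) order_refl)
  show ?thesis
  proof (rule pw_by_splitting[OF spl link, of "sup (P i) (P j)"])
    show "z \<le> y" "z \<le> sup (P i) (P j)" using wy persp_le zP by (auto intro: le_supI1)
    show "pw z (reach z P) p' y'" if l: "link p' y'" "y' \<le> sup (P i) (P j)" for p' y'
      by (rule pw_by_splitting[OF sl(1)[of "sup (P i) (P j)"], of p' y' "P i"])
        (use l zy zP in_in in_out in \<open>auto intro: pw_base\<close>)
    show "pw z (reach z P) p' y'" if l: "link p' y'" "inf y' (sup (P i) (P j)) = z" for p' y'
      by (rule pw_by_splitting[OF sl(2)[of "sup (P i) (P j)"], of p' y' "sup w (P i)"])
        (use l zy zw out_in out_out in \<open>auto intro: pw_base le_supI1\<close>)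
  qed
qed

lemma reach_chain:
  fixes P :: "nat \<Rightarrow> 'a::{modular_lattice, relatively_complemented_lattice}"
  assumes P: "indep3 z P" and q: "copies z P q" and c: "(persp z)\<^sup>+\<^sup>+ (q 0) y"
  shows "pw z (reach z P) (q 0) y"
  using c
proof (induction rule: tranclp_induct)
  case (base y)
  have "inf (P 0) (sup (P 1) (P 2)) = z" using P by (simp add: indep3_def)
  then have "inf (q 0) (sup (P 1) (P 2)) = z"
    by (rule disjoint_mono) (use copiesD[OF q] in \<open>auto intro: le_supI1\<close>)
  then have "reach z P (q 0) (q 0)"
    by (intro reachI[OF q HOL.refl, of 1 2]) (use copiesD(4)[OF q] in auto)
  then show ?case using reach_step[OF P] base by blast
next
  case (step y w)
  show ?case by (rule pw_bind[OF pw_persp[OF step.IH step.hyps(2)]]) (auto intro: reach_step[OF P])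
qed

lemma reach_appr:
  fixes P :: "nat \<Rightarrow> 'a::{modular_lattice, relatively_complemented_lattice}"
  assumes P: "indep3 z P" and q: "copies z P q" and a: "appr z (q 0) y"
  shows "pw z (reach z P) (q 0) y"
  using a unfolding appr_def
proof (rule pw_bind)
  fix u v assume c: "(persp z)\<^sup>+\<^sup>+ u v" and u: "u \<le> q 0"
  have "z \<le> u" using c persp_le by (metis tranclpD)
  then obtain u' where "oplus z u u' (q 0)" using sectional_complement_exists u by metis
  then obtain q1 q2 where "copies z P q1" "q1 0 = u" using copies_split[OF P q] by (metis zero_less_numeral)
  then show "pw z (reach z P) u v" using reach_chain[OF P] c by metis
qed

text \<open>
  A chain brings \<open>y\<close>, in pieces, next to two of the three copies. If \<open>p\<close> is not among these, one more
  cut by \<open>P 0 \<or> P i\<close> lets \<open>persp_trans\<close> bring it back to \<open>p\<close>.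
\<close>

lemma triplicated_persp:
  fixes p :: "'a::{modular_lattice, relatively_complemented_lattice}"
  assumes "triplicated z p" "appr z p y" "inf p y = z"
  shows "persp z p y"
proof -
  obtain P where P: "indep3 z P" "copies z P P" "P 0 = p" using assms(1) by (auto simp: triplicated_def)
  have "pw z (reach z P) p y" using reach_appr[OF P(1,2)] P(3) assms(2) by simp
  then have "pw z (persp z) p y"
  proof (rule pw_bind)
    fix u v assume r: "reach z P u v" and uv: "u \<le> p" "v \<le> y"
    then obtain i j q where ij: "i < 3" "j < 3" "i \<noteq> j" and q: "copies z P q" "q 0 = u" "persp z (q i) v"
      and d: "inf v (sup (P i) (P j)) = z"
      unfolding reach_def copied_def by blast
    note D = copiesD[OF q(1)]
    have zuv: "z \<le> u" "z \<le> v" using D(2)[of 0] q persp_le by auto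
    have duv: "inf u v = z" by (rule disjoint_mono[OF assms(3)]) (use uv zuv in auto)
    have p0: "persp z (q l) u" if "l < 3" for l using D(4)[of 0 l] that q(2) by simp
    consider "i = 0" | "j = 0" | "i \<noteq> 0" "j \<noteq> 0" by blast
    then show "pw z (persp z) u v"
    proof cases
      case 1
      then show ?thesis using q by (auto intro: pw_base)
    next
      case 2
      have "inf v (sup (q i) u) = z"
        by (rule disjoint_mono[OF d]) (use D(1)[of 0] D(1,2)[OF ij(1)] q 2 zuv in \<open>auto intro: le_supI1 le_supI2\<close>)
      then have "persp z v u" using persp_trans[OF persp_sym[OF q(3)] p0[OF ij(1)]] by blast
      then show ?thesis by (auto intro: pw_base persp_sym)
    next
      case 3
      let ?R = "\<lambda>a b. copied z P i a b \<and> inf a b = z"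
      have spl: "splitting z ?R"
        by (rule splitting_conj[OF splitting_copied[OF P(1) ij(1)]]) (metis disjoint_mono)
      have "inf (P j) (sup (P 0) (P i)) = z" using P(1) ij 3 unfolding indep3_def by (metis zero_less_numeral)
      note jd = this
      have zP: "z \<le> P 0" "z \<le> P i" using D(3)[of 0] D(3)[OF ij(1)] by auto
      show ?thesis
      proof (rule pw_by_splitting[OF spl, of _ _ "sup (P 0) (P i)"])
        show "?R u v" using q duv by (auto simp: copied_def)
        show "z \<le> v" "z \<le> sup (P 0) (P i)" using zuv zP by (auto intro: le_supI1)
      next
        fix a b assume ab: "?R a b" and b: "b \<le> sup (P 0) (P i)"
        obtain h where h: "copies z P h" "h 0 = a" "persp z (h i) b" using ab by (auto simp: copied_def)
        note H = copiesD[OF h(1)]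
        have hj: "h j \<le> P j" "z \<le> h j" "h i \<le> P i" "a \<le> P 0" "z \<le> h i" "z \<le> a"
          using H(1,2)[OF ij(2)] H(1,2)[OF ij(1)] H(1,2)[of 0] h by auto
        have "inf (h j) (sup (h i) b) = z" "inf (h j) (sup a b) = z"
          by (rule disjoint_mono[OF jd]; use hj b in \<open>auto intro: le_supI1 le_supI2\<close>)+
        moreover have "persp z (h j) (h i)" "persp z (h j) a" using H(4) ij h(2) by (metis zero_less_numeral)+
        ultimately have "persp z a b" using persp_trans persp_trans_middle h(3) ab by metis
        then show "pw z (persp z) a b" by (rule pw_base)
      next
        fix a b assume ab: "?R a b" and b: "inf b (sup (P 0) (P i)) = z"
        obtain h where h: "copies z P h" "h 0 = a" "persp z (h i) b" using ab by (auto simp: copied_def)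
        note H = copiesD[OF h(1)]
        have "inf b (sup (h i) a) = z"
          by (rule disjoint_mono[OF b]) (use H(1,2)[OF ij(1)] H(1,2)[of 0] h persp_le in \<open>auto intro: le_supI1 le_supI2\<close>)
        moreover have "persp z (h i) a" using H(4) ij h(2) by (metis zero_less_numeral)
        ultimately have "persp z b a" using persp_trans persp_sym h(3) by blast
        then show "pw z (persp z) a b" by (auto intro: pw_base persp_sym)
      qed
    qed
  qed
  then show ?thesis using assms(3) pw_persp_disjoint by blast
qed

text \<open>
  The pieces of \<open>x\<close> are themselves members of independent triples, so the preceding lemma applies with
  \<open>x\<close> in place of \<open>p\<close>.
\<close>

lemma triplicated_appr_persp:
  fixes p :: "'a::{modular_lattice, relatively_complemented_lattice}"
  assumes "triplicated z p" "appr z p x" "appr z p y" "inf x y = z"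
  shows "persp z x y"
proof -
  obtain P where P: "indep3 z P" "copies z P P" "P 0 = p" using assms(1) by (auto simp: triplicated_def)
  have "pw z (reach z P) p x" using reach_appr[OF P(1,2)] P(3) assms(2) by simp
  then show ?thesis using assms(3,4)
  proof (induction arbitrary: y rule: pw.induct)
    case (pw_base p x)
    then obtain i j q where ij: "i < 3" "j < 3" "i \<noteq> j" and q: "copies z P q" "q 0 = p" "persp z (q i) x"
      and d: "inf x (sup (P i) (P j)) = z"
      unfolding reach_def copied_def by blast
    note D = copiesD[OF q(1)]
    have le: "z \<le> q i" "z \<le> q j" "q i \<le> P i" "q j \<le> P j" "z \<le> x" using D ij q(3) persp_le by blast+
    have dx: "inf x (sup (q i) (q j)) = z"
      by (rule disjoint_mono[OF d]) (use le in \<open>auto intro: le_supI1 le_supI2\<close>)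
    have dq: "inf (q j) (q i) = z"
      by (rule disjoint_mono[OF indep3_pair[OF P(1) q(1) ij(2,1)]]) (use le ij in auto)
    have "triplicated z x"
    proof (rule triplicatedI)
      show "inf x (q i) = z" by (rule disjoint_mono[OF dx]) (use le in auto)
      show "inf (sup x (q i)) (q j) = z"
        using indep_shift[OF dq, of x] dx by (simp add: inf.commute sup.commute)
      show "persp z x (q i)" using q persp_sym by blast
      then show "persp z x (q j)" using persp_trans D(4)[OF ij(2,1)] dx by blast
    qed
    moreover have "appr z x p"
      using appr_persp_trans persp_imp_appr persp_sym[OF q(3)] D(4)[of 0 i] ij q(2) by (metis zero_less_numeral)
    then have "appr z x y" using appr_trans pw_base by blast
    ultimately show ?case using triplicated_persp pw_base by blast
  next
    case (pw_sum p1 x1 p2 x2 p x)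
    obtain y1 y2 where y: "oplus z y1 y2 y" "appr z y1 p1" "appr z y2 p2"
      using splittingD[OF splitting_appr appr_sym[OF pw_sum.prems(1)] pw_sum.hyps(3)] .
    note le = oplus_le[OF y(1)] oplus_le[OF pw_sum.hyps(4)]
    have "inf x1 y1 = z" "inf x2 y2 = z"
      by (rule disjoint_mono[OF pw_sum.prems(2)]; use le in simp)+
    then have "persp z x1 y1" "persp z x2 y2" using pw_sum.IH appr_sym y by blast+
    then show ?case using persp_oplus pw_sum.hyps(4) y(1) pw_sum.prems(2) by blast
  qed
qed

lemma triplicated_lower:
  fixes p :: "'a::{modular_lattice, relatively_complemented_lattice}"
  assumes "triplicated z p" "oplus w z p' p"
  shows "triplicated w p'"
proof -
  obtain p1 p2 where p: "inf p p1 = z" "inf (sup p p1) p2 = z" "persp z p p1" "persp z p p2"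
    using triplicatedE[OF assms(1)] .
  have wz: "w \<le> z" using oplus_le[OF assms(2)] by simp
  obtain q1 where q1: "oplus w z q1 p1" using sectional_complement_exists[OF wz] p persp_le by metis
  obtain q2 where q2: "oplus w z q2 p2" using sectional_complement_exists[OF wz] p persp_le by metis
  have d2: "inf p p2 = z" by (rule disjoint_mono[OF p(2)]) (use p persp_le in auto)
  show ?thesis
  proof (rule triplicatedI)
    show "inf p' q1 = w" using indep_complements(1) assms(2) q1 p(1) by blast
    show "persp w p' q1" using persp_lower_iff[OF assms(2) q1 p(1)] p by blast
    show "persp w p' q2" using persp_lower_iff[OF assms(2) q2 d2] p by blast
    have "oplus w z (sup p' q1) (sup p p1)"
      using indep_complements(2)[OF assms(2) q1 p(1)] assms(2) q1 unfolding oplus_def by (metis sup.assoc sup.commute sup.left_idem)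
    then show "inf (sup p' q1) q2 = w" using indep_complements(1) q2 p(2) by blast
  qed
qed

section \<open>Dimensions on which disjoint elements are perspective\<close>

text \<open>
  The goal, localised to one dimension. It quantifies over all zeros, which allows passing to a
  smaller zero in the middle of a proof.
\<close>

definition persp_dim :: "'a::lattice Dim \<Rightarrow> bool" where
  "persp_dim \<delta> \<longleftrightarrow> (\<forall>z x y. inf x y = z \<longrightarrow> Delta z x = \<delta> \<longrightarrow> Delta z y = \<delta> \<longrightarrow> persp z x y)"

text \<open>
  The hereditary version. It is the one that can be used for elements about which only a bound on the
  dimension is known, and it is preserved under sums of elements.
\<close>

definition hpersp_dim :: "'a::lattice Dim \<Rightarrow> bool" where
  "hpersp_dim \<delta> \<longleftrightarrow> (\<forall>\<epsilon>. alg_le \<epsilon> \<delta> \<longrightarrow> persp_dim \<epsilon>)"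

lemma persp_dimD: "persp_dim \<delta> \<Longrightarrow> Delta z x = \<delta> \<Longrightarrow> Delta z y = \<delta> \<Longrightarrow> inf x y = z \<Longrightarrow> persp z x y"
  by (auto simp: persp_dim_def)

lemma alg_le_Delta: "z \<le> u \<Longrightarrow> u \<le> p \<Longrightarrow> alg_le (Delta z u) (Delta z p)"
  unfolding alg_le_def using Delta_D1 by metis

lemma persp_dim_add:
  fixes \<delta> \<epsilon> :: "'a::{modular_lattice, relatively_complemented_lattice} Dim"
  assumes "persp_dim \<delta>" "persp_dim \<epsilon>" shows "persp_dim (\<delta> + \<epsilon>)"
  unfolding persp_dim_def
proof (intro allI impI)
  fix z x y :: 'a
  assume d: "inf x y = z" and x: "Delta z x = \<delta> + \<epsilon>" and y: "Delta z y = \<delta> + \<epsilon>"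
  obtain x1 x2 where x': "oplus z x1 x2 x" "Delta z x1 = \<delta>" "Delta z x2 = \<epsilon>"
    using Delta_eq_sum_refine[OF x disjoint_ge(1)[OF d]] .
  obtain y1 y2 where y': "oplus z y1 y2 y" "Delta z y1 = \<delta>" "Delta z y2 = \<epsilon>"
    using Delta_eq_sum_refine[OF y disjoint_ge(2)[OF d]] .
  have "inf x1 y1 = z" "inf x2 y2 = z"
    by (rule disjoint_mono[OF d]; use oplus_le[OF x'(1)] oplus_le[OF y'(1)] in simp)+
  then show "persp z x y"
    using persp_oplus[OF x'(1) y'(1) d] persp_dimD[OF assms(1) x'(2) y'(2)] persp_dimD[OF assms(2) x'(3) y'(3)] by blast
qed

text \<open>
  On the level of dimensions two decompositions of an element do have a common refinement.
\<close>

lemma Delta_two_decompositions: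
  fixes p :: "'a::modular_lattice"
  assumes "oplus z p1 p2 p" "oplus z a b p"
  obtains \<alpha>1 \<alpha>2 \<beta>1 \<beta>2 where "Delta z a = \<alpha>1 + \<alpha>2" "Delta z b = \<beta>1 + \<beta>2"
    "Delta z p1 = \<alpha>1 + \<beta>1" "Delta z p2 = \<alpha>2 + \<beta>2"
proof
  note le = oplus_le[OF assms(1)] oplus_le[OF assms(2)]
  have s: "sup p1 a \<le> p" "z \<le> inf p1 a" using le by auto
  show "Delta z a = Delta z (inf p1 a) + Delta (inf p1 a) a"
    by (rule Delta_D1) (use s in auto)
  show "Delta z p1 = Delta z (inf p1 a) + Delta (inf p1 a) p1"
    by (rule Delta_D1) (use s in auto)
  have "Delta z b = Delta a (sup p1 a) + Delta (sup p1 a) p"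
    unfolding Delta_complement[OF assms(2)] by (rule Delta_D1) (use s in auto)
  then show "Delta z b = Delta (inf p1 a) p1 + Delta (sup p1 a) p"
    using Delta_D2[of a p1] by (simp add: inf.commute sup.commute)
  have "Delta z p2 = Delta p1 (sup p1 a) + Delta (sup p1 a) p"
    unfolding Delta_complement[OF assms(1)] by (rule Delta_D1) (use s in auto)
  then show "Delta z p2 = Delta (inf p1 a) a + Delta (sup p1 a) p"
    using Delta_D2[of p1 a] by simp
qed

lemma hpersp_dim_oplus:
  fixes p :: "'a::{modular_lattice, relatively_complemented_lattice}"
  assumes p: "oplus z p1 p2 p" and h: "hpersp_dim (Delta z p1)" "hpersp_dim (Delta z p2)"
  shows "hpersp_dim (Delta z p)"
  unfolding hpersp_dim_def
proof (intro allI impI)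
  fix \<epsilon> :: "'a Dim" assume "alg_le \<epsilon> (Delta z p)"
  then obtain \<gamma> where "Delta z p = \<epsilon> + \<gamma>" by (metis alg_le_def)
  then obtain a b where a: "oplus z a b p" "Delta z a = \<epsilon>"
    using Delta_eq_sum_refine oplus_le(5)[OF p] by metis
  obtain \<alpha>1 \<alpha>2 \<beta>1 \<beta>2 where "Delta z a = \<alpha>1 + \<alpha>2" "Delta z p1 = \<alpha>1 + \<beta>1" "Delta z p2 = \<alpha>2 + \<beta>2"
    using Delta_two_decompositions[OF p a(1)] by metis
  then show "persp_dim \<epsilon>"
    using persp_dim_add h a(2) unfolding hpersp_dim_def alg_le_def by metis
qed

lemma hpersp_dim_triplicated:
  fixes p :: "'a::{modular_lattice, relatively_complemented_lattice}"
  assumes "triplicated z p"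
  shows "hpersp_dim (Delta z p)"
proof -
  have main: "persp_dim (Delta z p)" if t: "triplicated z p" for p :: 'a
    unfolding persp_dim_def
  proof (intro allI impI)
    fix v x y :: 'a
    assume d: "inf x y = v" and x: "Delta v x = Delta z p" and y: "Delta v y = Delta z p"
    have zp: "z \<le> p" using t triplicatedE persp_le by metis
    have vx: "v \<le> x" "v \<le> y" using d disjoint_ge by auto
    obtain w1 where w1: "\<And>w x' y'. w \<le> w1 \<Longrightarrow> oplus w z x' p \<Longrightarrow> oplus w v y' x \<Longrightarrow> appr w x' y'"
      using Delta_eq_imp_appr[OF x[symmetric] zp vx(1)] by blast
    obtain w2 where w2: "\<And>w x' y'. w \<le> w2 \<Longrightarrow> oplus w z x' p \<Longrightarrow> oplus w v y' y \<Longrightarrow> appr w x' y'"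
      using Delta_eq_imp_appr[OF y[symmetric] zp vx(2)] by blast
    let ?w = "inf (inf w1 w2) (inf z v)"
    have le: "?w \<le> w1" "?w \<le> w2" "?w \<le> z" "?w \<le> v" by (auto intro: le_infI1 le_infI2)
    obtain p' where p': "oplus ?w z p' p" using sectional_complement_exists[OF le(3) zp] .
    obtain x' where x': "oplus ?w v x' x" using sectional_complement_exists[OF le(4) vx(1)] .
    obtain y' where y': "oplus ?w v y' y" using sectional_complement_exists[OF le(4) vx(2)] .
    have "persp ?w x' y'"
      using triplicated_appr_persp[OF triplicated_lower[OF t p'] w1[OF le(1) p' x'] w2[OF le(2) p' y']]
        indep_complements(1)[OF x' y' d] by blast
    then show "persp v x y" using persp_lower_iff[OF x' y' d] by blast
  qed
  show ?thesis
    unfolding hpersp_dim_def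
  proof (intro allI impI)
    fix \<epsilon> :: "'a Dim" assume "alg_le \<epsilon> (Delta z p)"
    then obtain \<gamma> where g: "Delta z p = \<epsilon> + \<gamma>" by (metis alg_le_def)
    have zp: "z \<le> p" using assms triplicatedE persp_le by metis
    obtain a b where a: "oplus z a b p" "Delta z a = \<epsilon>" using Delta_eq_sum_refine[OF g zp] .
    obtain p1 p2 where p: "inf p p1 = z" "inf (sup p p1) p2 = z" "persp z p p1" "persp z p p2"
      using triplicatedE[OF assms] .
    obtain a1 where a1: "persp z a a1" "a1 \<le> p1" using persp_split[OF p(3) a(1)] oplus_le(1) by metis
    obtain a2 where a2: "persp z a a2" "a2 \<le> p2" using persp_split[OF p(4) a(1)] oplus_le(1) by metis
    have "triplicated z a"
    proof (rule triplicatedI[OF _ _ a1(1) a2(1)])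
      show "inf a a1 = z" by (rule disjoint_mono[OF p(1)]) (use a1 a2 persp_le oplus_le[OF a(1)] in auto)
      show "inf (sup a a1) a2 = z"
        by (rule disjoint_mono[OF p(2)]) (use a1 a2 persp_le oplus_le[OF a(1)] in \<open>auto intro: le_supI1 le_supI2\<close>)
    qed
    then show "persp_dim \<epsilon>" using main a by blast
  qed
qed

text \<open>
  All elements of the chain lie in \<open>e\<close> and \<open>v\<close> is disjoint from \<open>e\<close>, so \<open>persp_trans\<close> walks back along
  the chain.
\<close>

lemma first_exit:
  fixes a b v e :: "'a::modular_lattice"
  assumes "(\<lambda>x y. persp z x y \<and> x \<le> e \<and> y \<le> e)\<^sup>+\<^sup>+ a b" "persp z b v" "inf v e = z"
  shows "persp z a v"
  using assms
proof (induction arbitrary: v rule: tranclp_induct)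
  case (base b)
  have "inf v (sup b a) = z"
    by (rule disjoint_mono[OF base(3)]) (use base persp_le in \<open>auto intro: le_supI1\<close>)
  then show ?case using base persp_sym persp_trans by metis
next
  case (step y b)
  note le = persp_le[OF step.prems(1)]
  have "inf v (sup b y) = z"
    by (rule disjoint_mono[OF step.prems(2)]) (use step.hyps(2) le in \<open>simp_all add: le_supI1\<close>)
  then have "persp z y v" using step persp_sym persp_trans by metis
  then show ?case using step by blast
qed

text \<open>
  Follow a chain from \<open>u\<close> to \<open>r\<close> and cut each element by \<open>u \<or> u'\<close>. As soon as a piece is outside, its
  origin in \<open>u\<close> has three independent copies: itself, its image in \<open>u'\<close>, and the piece outside
  (\<open>first_exit\<close>). Since \<open>r\<close> is outside, only zero pieces remain inside.
\<close>

lemma hpersp_dim_exit: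
  fixes u u' r :: "'a::{modular_lattice, relatively_complemented_lattice}"
  assumes uu: "persp z u u'" and d: "inf u u' = z" and r: "inf r (sup u u') = z" and a: "appr z u r"
  shows "hpersp_dim (Delta z u)"
proof -
  let ?e = "sup u u'"
  let ?in = "(\<lambda>x y. persp z x y \<and> x \<le> ?e \<and> y \<le> ?e)\<^sup>+\<^sup>+"
  \<comment> \<open>A piece is either known to be triplicated or its chain has stayed inside so far.\<close>
  define X where "X = (\<lambda>a b. triplicated z a \<or> (a \<le> u \<and> ?in a b))"
  have zu: "z \<le> u" "z \<le> ?e" using d disjoint_ge by (auto intro: le_supI1)
  have trip: "triplicated z a" if h: "a \<le> u" "persp z a v" "inf v ?e = z" for a v
  proof -
    have "z \<le> a" using h persp_le by blast
    then obtain a2 where "oplus z a a2 u" using h(1) sectional_complement_exists by metis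
    then obtain a' where a': "persp z a a'" "a' \<le> u'" using persp_split[OF uu] oplus_le(1) by metis
    show ?thesis
    proof (rule triplicatedI[OF _ _ a'(1) h(2)])
      show "inf a a' = z" by (rule disjoint_mono[OF d]) (use h a' persp_le in auto)
      show "inf (sup a a') v = z"
        unfolding inf.commute[of _ v]
        by (rule disjoint_mono[OF h(3)]) (use h a' persp_le in \<open>auto intro: le_supI1 le_supI2\<close>)
    qed
  qed
  have extend: "pw z X a w" if X: "X a b" and bw: "persp z b w" for a b w
  proof (cases "triplicated z a")
    case True
    then show ?thesis by (auto simp: X_def intro: pw_base)
  next
    case False
    let ?R = "(\<lambda>a b. ?in a b \<and> a \<le> u) OO persp z"
    have "splitting z (\<lambda>x y. persp z x y \<and> x \<le> ?e \<and> y \<le> ?e)"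
      by (rule splitting_conj[OF splitting_persp]) (auto intro: order_trans)
    then have spl: "splitting z ?R"
      by (intro splitting_comp splitting_persp splitting_conj splitting_tranclp) (auto intro: order_trans)
    have Raw: "?R a w" using False X bw by (auto simp: X_def)
    show ?thesis
    proof (rule pw_by_splitting[OF spl Raw persp_le(2)[OF bw] zu(2)])
      fix a' w' assume R: "?R a' w'" and w': "w' \<le> ?e"
      then obtain b' where b': "?in a' b'" "a' \<le> u" "persp z b' w'" by blast
      then have "b' \<le> ?e" by (metis (no_types, lifting) tranclp.cases)
      then have "?in a' w'" using b' w' by (auto intro: tranclp.trancl_into_trancl)
      then show "pw z X a' w'" using b' by (auto simp: X_def intro: pw_base)
    next
      fix a' w' assume R: "?R a' w'" and w': "inf w' ?e = z"
      then have "persp z a' w'" "a' \<le> u" using first_exit by blast+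
      then show "pw z X a' w'" using trip w' by (auto simp: X_def intro: pw_base)
    qed
  qed
  have chain: "pw z X a b" if "(persp z)\<^sup>+\<^sup>+ a b" "a \<le> u" for a b
    using that(1)
  proof (induction rule: tranclp_induct)
    case (base b)
    have "z \<le> a" using base persp_le by blast
    then have "?in a a" using that(2) persp_refl[of z a] by (auto intro!: tranclp.r_into_trancl le_supI1)
    then have "X a a" using that(2) by (simp add: X_def)
    then show ?case using extend base by blast
  next
    case (step b c)
    show ?case by (rule pw_bind[OF pw_persp[OF step.IH step.hyps(2)]]) (auto intro: extend)
  qed
  have "pw z X u r" by (rule pw_bind[OF a[unfolded appr_def] chain])
  then have "pw z (\<lambda>a b. triplicated z a) u r"
  proof (rule pw_bind)
    fix a b assume X: "X a b" and b: "b \<le> r"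
    have "triplicated z a" if i: "?in a b"
    proof -
      have "b \<le> ?e" "z \<le> b" using i by (metis (no_types, lifting) persp_le(2) tranclp.cases)+
      then have "b = z" using b r by (metis antisym inf.boundedI)
      moreover have "(persp z)\<^sup>+\<^sup>+ a b" using i by (induction rule: tranclp_induct) (auto intro: tranclp.intros)
      ultimately have "appr z a z" unfolding appr_def by (simp add: pw_base)
      then have "a = z" by (rule appr_zero)
      then show ?thesis using triplicatedI[of z z z z] persp_refl[of z z] by simp
    qed
    then show "pw z (\<lambda>a b. triplicated z a) a b" using X by (auto simp: X_def intro: pw_base)
  qed
  then show ?thesis
    by (induction rule: pw.induct) (auto intro: hpersp_dim_triplicated hpersp_dim_oplus)
qed

text \<open>
  The dimension of \<open>r\<close> is that of \<open>u\<close>, so over a smaller zero there is a chain.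
\<close>

lemma hpersp_dim_room:
  fixes u u' r :: "'a::{modular_lattice, relatively_complemented_lattice}"
  assumes uu: "persp z u u'" and d: "inf u u' = z" and r: "inf r (sup u u') = z" and D: "Delta z u = Delta z r"
  shows "hpersp_dim (Delta z u)"
proof -
  have le: "z \<le> u" "z \<le> u'" "z \<le> r" using disjoint_ge[OF d] disjoint_ge[OF r] by auto
  obtain w0 where w0: "\<And>w x' y'. w \<le> w0 \<Longrightarrow> oplus w z x' u \<Longrightarrow> oplus w z y' r \<Longrightarrow> appr w x' y'"
    using Delta_eq_imp_appr[OF D le(1,3)] by blast
  let ?w = "inf w0 z"
  have w: "?w \<le> w0" "?w \<le> z" by auto
  obtain v where v: "oplus ?w z v u" using sectional_complement_exists[OF w(2) le(1)] .
  obtain v' where v': "oplus ?w z v' u'" using sectional_complement_exists[OF w(2) le(2)] .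
  obtain s where s: "oplus ?w z s r" using sectional_complement_exists[OF w(2) le(3)] .
  have "oplus ?w z (sup v v') (sup u u')"
    using indep_complements(2)[OF v v' d] v v' unfolding oplus_def by (metis sup.assoc sup.commute sup.left_idem)
  then have "inf s (sup v v') = ?w" using indep_complements(1)[OF s] r by blast
  moreover have "inf v v' = ?w" using indep_complements(1)[OF v v' d] .
  moreover have "persp ?w v v'" using persp_lower_iff[OF v v' d] uu by blast
  ultimately have "hpersp_dim (Delta ?w v)" using hpersp_dim_exit w0[OF w(1) v s] by blast
  then show ?thesis using Delta_complement[OF v] by simp
qed

text \<open>
  The third element may be taken next to \<open>v\<close> inside \<open>y\<close>, as the perspective copy of \<open>v\<close> lies in \<open>w\<close>.
\<close>

lemma hpersp_dim_below:
  fixes y w :: "'a::{modular_lattice, relatively_complemented_lattice}"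
  assumes yw: "persp z y w" "inf y w = z" and v: "v \<le> y" "r \<le> y" "inf v r = z" and D: "Delta z v = Delta z r"
  shows "hpersp_dim (Delta z v)"
proof -
  have le: "z \<le> v" "z \<le> r" using v disjoint_ge by auto
  obtain v2 where "oplus z v v2 y" using sectional_complement_exists[OF le(1) v(1)] .
  then obtain v' where v': "persp z v v'" "v' \<le> w" using persp_split[OF yw(1)] oplus_le(1) by metis
  have "inf v v' = z" by (rule disjoint_mono[OF yw(2)]) (use v v' le persp_le in auto)
  moreover have "inf (sup r v) v' = z"
    by (rule disjoint_mono[OF yw(2)]) (use v v' le persp_le in \<open>auto intro: le_supI1\<close>)
  then have "inf r (sup v v') = z" using indep_shift v(3) by (metis inf.commute)
  ultimately show ?thesis using hpersp_dim_room[OF v'(1)] D by blast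
qed

section \<open>The cancellation axiom\<close>

context
  assumes cancel: "\<forall>x y z :: ('a::{modular_lattice, relatively_complemented_lattice}) Dim.
     x + z = y + z \<longrightarrow> (\<exists>t. alg_le (t + t) z \<and> x + t = y + t)"
begin

lemma cancel_halves:
  fixes m :: 'a
  assumes "\<alpha> + Delta z m = \<beta> + Delta z m" "z \<le> m"
  obtains t u r w where "\<alpha> + t = \<beta> + t" "Delta z u = t" "Delta z r = t"
    "oplus z u r (sup u r)" "oplus z (sup u r) w m"
proof -
  obtain t where t: "alg_le (t + t) (Delta z m)" "\<alpha> + t = \<beta> + t" using cancel assms(1) by blast
  then obtain \<gamma> where "Delta z m = (t + t) + \<gamma>" by (metis alg_le_def)
  then obtain ur w where ur: "oplus z ur w m" "Delta z ur = t + t" using Delta_eq_sum_refine assms(2) by metis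
  then obtain u r where "oplus z u r ur" "Delta z u = t" "Delta z r = t"
    using Delta_eq_sum_refine oplus_le(3) by metis
  then show ?thesis using that t ur by (auto simp: oplus_def)
qed

text \<open>
  Put \<open>m = p \<and> q\<close>, \<open>p = m \<oplus> a\<close>, \<open>q = m \<oplus> b\<close>, and let the axiom give \<open>m = u \<oplus> r \<oplus> w'\<close> with
  \<open>D(a) + D(u) = D(b) + D(u)\<close> and \<open>D(u) = D(r)\<close>. The common part is \<open>r \<oplus> w'\<close>; the rests are
  \<open>u \<oplus> a\<close> and \<open>u \<oplus> b\<close>. Here \<open>r\<close> gives room for \<open>u\<close>, and a part of \<open>p\<close> with the dimension of \<open>b\<close>
  gives room for \<open>b\<close>, because \<open>b\<close> is disjoint from \<open>p\<close>.
\<close>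

lemma common_part:
  fixes p q :: 'a
  assumes yw: "persp z y w" "inf y w = z" and p: "p \<le> y" "q \<le> y" "z \<le> p" "z \<le> q"
    and D: "Delta z p = Delta z q"
  obtains p0 q0 c where "oplus z p0 c p" "oplus z q0 c q" "Delta z p0 = Delta z q0" "hpersp_dim (Delta z p0)"
proof -
  let ?m = "inf p q"
  have m: "z \<le> ?m" using p by simp
  obtain a where a: "oplus z ?m a p" using sectional_complement_exists[OF m inf.cobounded1] .
  obtain b where b: "oplus z ?m b q" using sectional_complement_exists[OF m inf.cobounded2] .
  have Dab: "Delta z p = Delta z ?m + Delta z b" using D Delta_oplus[OF b] by simp
  then have "Delta z a + Delta z ?m = Delta z b + Delta z ?m"
    using Delta_oplus[OF a] by (simp add: add.commute)
  then obtain t u r w' where t: "Delta z a + t = Delta z b + t" and u: "Delta z u = t" "Delta z r = t"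
    "oplus z u r (sup u r)" "oplus z (sup u r) w' ?m"
    using cancel_halves m by metis
  have le: "u \<le> ?m" "r \<le> ?m" "a \<le> p" "b \<le> q"
    using oplus_le(1)[OF u(4)] oplus_le(2)[OF a] oplus_le(2)[OF b] by (auto simp del: inf.bounded_iff)
  have hu: "hpersp_dim (Delta z u)"
  proof (rule hpersp_dim_below[OF yw])
    show "u \<le> y" "r \<le> y" using le p by auto
  qed (use u in \<open>auto simp: oplus_def\<close>)
  obtain x1 x2 where x: "oplus z x1 x2 p" "Delta z x2 = Delta z b" using Delta_eq_sum_refine[OF Dab p(3)] .
  have hb: "hpersp_dim (Delta z b)"
  proof (rule hpersp_dim_below[OF yw])
    have "inf b ?m = z" using b by (simp add: oplus_def inf.commute)
    then have "inf b p = z" using le(4) by (metis inf.absorb1 inf.assoc inf.commute)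
    then show "inf b x2 = z" by (rule disjoint_mono) (use oplus_le[OF x(1)] oplus_le[OF b] in auto)
    show "b \<le> y" "x2 \<le> y" using le p oplus_le(2)[OF x(1)] by auto
  qed (use x in simp)
  let ?c = "sup r w'"
  have c: "oplus z u ?c ?m" using oplus_assoc(2)[OF u(3,4)] .
  then have c': "oplus z ?c u ?m" by (simp add: oplus_commute)
  note pa = oplus_assoc[OF c' a] and qb = oplus_assoc[OF c' b]
  show ?thesis
  proof
    show "oplus z (sup u a) ?c p" "oplus z (sup u b) ?c q" using pa(2) qb(2) by (simp_all add: oplus_commute)
    show e: "Delta z (sup u a) = Delta z (sup u b)"
      using Delta_oplus[OF pa(1)] Delta_oplus[OF qb(1)] u(1) t by (simp add: add.commute)
    show "hpersp_dim (Delta z (sup u a))" unfolding e using hpersp_dim_oplus[OF qb(1) hu hb] .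
  qed
qed

text \<open>
  The decomposition in the theorem: \<open>a\<^sub>0 = u \<oplus> p'\<close>, \<open>a\<^sub>1 = r \<oplus> w\<close>, \<open>b\<^sub>0 = r \<oplus> q'\<close>, \<open>b\<^sub>1 = u \<oplus> w\<close>, where the
  axiom gives \<open>p \<and> q = u \<oplus> r \<oplus> w\<close>. It is stated for a single well-behaved dimension because it is
  needed in the proof that all dimensions are well-behaved.
\<close>

lemma hpersp_dim_decomposition:
  fixes p q :: 'a
  assumes h: "hpersp_dim (Delta z p)" and D: "Delta z p = Delta z q"
    and p: "oplus z (inf p q) p' p" and q: "oplus z (inf p q) q' q"
  shows "\<exists>a0 a1 b0 b1. oplus z a0 a1 p \<and> oplus z b0 b1 q \<and> persp z a0 b0 \<and> persp z a1 b1 \<and>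
    inf a0 b0 = z \<and> p' \<le> a0 \<and> q' \<le> b0 \<and> a1 \<le> inf p q \<and> b1 \<le> inf p q"
proof -
  let ?m = "inf p q"
  have lep: "z \<le> p" "z \<le> ?m" "p' \<le> p" "?m \<le> p" and leq: "z \<le> q" "q' \<le> q" "?m \<le> q"
    using oplus_le[OF p] oplus_le[OF q] by auto
  have "Delta z p' + Delta z ?m = Delta z q' + Delta z ?m"
    using D Delta_oplus[OF p] Delta_oplus[OF q] by (simp add: add.commute)
  then obtain t u r w where t: "Delta z p' + t = Delta z q' + t" and u: "Delta z u = t" "Delta z r = t"
    "oplus z u r (sup u r)" "oplus z (sup u r) w ?m"
    using cancel_halves lep by metis
  have r: "oplus z r u (sup u r)" using u(3) by (simp add: oplus_commute)
  let ?a1 = "sup r w" and ?b1 = "sup u w"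
  have a1: "oplus z u ?a1 ?m" using oplus_assoc(2)[OF u(3,4)] .
  have b1: "oplus z r ?b1 ?m" using oplus_assoc(2)[OF r u(4)] .
  have a1': "oplus z ?a1 u ?m" and b1': "oplus z ?b1 r ?m" using a1 b1 by (simp_all add: oplus_commute)
  note a0 = oplus_assoc[OF a1' p] and b0 = oplus_assoc[OF b1' q]
  let ?a0 = "sup u p'" and ?b0 = "sup r q'"
  have D0: "Delta z ?a0 = Delta z ?b0"
    using Delta_oplus[OF a0(1)] Delta_oplus[OF b0(1)] t u by (simp add: add.commute)
  have mq: "inf ?m q' = z" and mp: "inf ?m p' = z" using p q by (auto simp: oplus_def)
  have "inf q p' = inf ?m p'" using lep by (metis inf.absorb1 inf.assoc inf.commute)
  then have "inf (sup ?m q') p' = z" using mp q by (simp add: oplus_def)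
  then have mqp: "inf ?m (sup q' p') = z" using indep_shift mq by blast
  have pq: "inf p' q' = z"
    by (subst inf.commute, rule disjoint_mono[of q p' z])
      (use \<open>inf q p' = inf ?m p'\<close> mp leq oplus_le[OF p] oplus_le[OF q] in simp_all)
  have "inf (sup u r) (sup p' q') = z"
    unfolding sup.commute[of p' q']
    by (rule disjoint_mono[OF mqp]) (use oplus_le[OF u(4)] oplus_le[OF p] in \<open>auto intro: le_supI2\<close>)
  moreover have "inf u r = z" using u(3) by (simp add: oplus_def)
  ultimately have d0: "inf ?a0 ?b0 = z" using pq by (simp add: indep_pairs)
  have "alg_le (Delta z ?a0) (Delta z p)"
    using alg_le_Delta oplus_le[OF a0(2)] by blast
  then have "persp_dim (Delta z ?a0)" using h by (simp add: hpersp_dim_def)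
  then have p0: "persp z ?a0 ?b0" using persp_dimD D0 d0 by metis
  have "alg_le (Delta z u) (Delta z p)"
    by (rule alg_le_Delta) (use oplus_le[OF a1] lep in auto)
  then have "persp_dim (Delta z u)" using h by (simp add: hpersp_dim_def)
  then have "persp z r u" using persp_dimD[of "Delta z u" z r u] u r by (simp add: oplus_def)
  moreover have "inf (sup r u) w = z" using u(4) by (simp add: oplus_def sup.commute)
  ultimately have p1: "persp z ?a1 ?b1" using persp_add_common by blast
  show ?thesis
    using a0(2) b0(2) p0 p1 d0 oplus_le(2)[OF a1] oplus_le(2)[OF b1]
    by (intro exI[of _ ?a0] exI[of _ ?a1] exI[of _ ?b0] exI[of _ ?b1]) (simp add: oplus_commute)
qed

lemma hpersp_dim_pw:
  fixes p q :: 'a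
  assumes "hpersp_dim (Delta z p)" "Delta z p = Delta z q" "z \<le> p" "z \<le> q"
  shows "pw z (persp z) p q"
proof -
  have m: "z \<le> inf p q" using assms by simp
  obtain p' where p': "oplus z (inf p q) p' p" using sectional_complement_exists[OF m inf.cobounded1] .
  obtain q' where q': "oplus z (inf p q) q' q" using sectional_complement_exists[OF m inf.cobounded2] .
  show ?thesis using hpersp_dim_decomposition[OF assms(1,2) p' q'] by (blast intro: pw_base pw_sum)
qed

text \<open>
  Cut \<open>x\<close> by \<open>y \<or> w\<close>. Outside, \<open>persp_trans\<close> applies. A part inside is either contained in \<open>w\<close> or,
  being disjoint from \<open>w\<close>, perspective with axis \<open>w\<close> to an element of \<open>y\<close>. So up to one perspectivity
  both ends lie in \<open>w\<close>, or both in \<open>y\<close>, and have the same dimension. On their common part one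
  perspectivity is left, and on the rest \<open>hpersp_dim_pw\<close> applies.
\<close>

lemma persp_persp_disjoint:
  fixes x y w :: 'a
  assumes yw: "persp z y w" and d: "inf y w = z" and wx: "persp z w x"
  shows "pw z (persp z) y x"
proof -
  \<comment> \<open>\<open>R b a\<close>: the part of \<open>y \<sim> w \<sim> x\<close> over a piece \<open>a\<close> of \<open>x\<close>, with the bounds that locate it.\<close>
  define R where "R = (\<lambda>b v. persp z b v \<and> (b \<le> y \<and> v \<le> w)) OO persp z"
  have spl: "splitting z R"
    unfolding R_def by (intro splitting_comp splitting_persp splitting_conj) auto
  have RE: "\<exists>v. persp z b v \<and> b \<le> y \<and> v \<le> w \<and> persp z v a \<and> z \<le> a \<and> z \<le> b \<and> z \<le> v" if "R b a" for b a
    using that persp_le unfolding R_def by blast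
  have zs: "z \<le> y" "z \<le> w" "z \<le> x" "z \<le> sup y w" using yw wx persp_le by (auto intro: le_supI1)
  have sl: "splitting z (\<lambda>b a. R b a \<and> a \<le> sup y w)"
    by (rule splitting_conj[OF spl]) auto
  show ?thesis
  proof (rule pw_by_splitting[OF spl _ zs(3,4)])
    show "R y x" unfolding R_def using yw wx by blast
  next
    fix b a assume "R b a" and a: "inf a (sup y w) = z"
    then obtain v where v: "persp z b v" "b \<le> y" "v \<le> w" "persp z v a" "z \<le> b" "z \<le> v" using RE by blast
    have "inf a (sup v b) = z"
      by (rule disjoint_mono[OF a]) (use v a disjoint_ge in \<open>auto intro: le_supI1 le_supI2\<close>)
    then have "persp z a b" using persp_trans persp_sym v by blast
    then show "pw z (persp z) b a" by (auto intro: pw_base persp_sym)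
  next
    fix b a assume "R b a" and a: "a \<le> sup y w"
    then show "pw z (persp z) b a"
    proof (intro pw_by_splitting[OF sl _ _ zs(2), of b a])
      show "z \<le> a" if "R b a" using RE that by blast
    next
      fix b a assume "R b a \<and> a \<le> sup y w" and a: "a \<le> w"
      then obtain v where v: "persp z b v" "b \<le> y" "v \<le> w" "persp z v a" "z \<le> a" "z \<le> b" "z \<le> v" using RE by blast
      have wy: "persp z w y" "inf w y = z" using yw d persp_sym by (auto simp: inf.commute)
      have D: "Delta z a = Delta z v" using Delta_persp[OF v(4)] by simp
      obtain a0 v0 c where c: "oplus z a0 c a" "oplus z v0 c v" "Delta z a0 = Delta z v0" "hpersp_dim (Delta z a0)"
        using common_part[OF wy a v(3) v(5,7) D] that by metis
      obtain b0 b1 where b: "oplus z b0 b1 b" "persp z v0 b0" "persp z c b1"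
        using persp_split[OF persp_sym[OF v(1)] c(2)] .
      have "Delta z b0 = Delta z a0" using Delta_persp[OF b(2)] c by simp
      then have "pw z (persp z) b0 a0"
        using hpersp_dim_pw[of z b0 a0] c oplus_le(3)[OF b(1)] oplus_le(3)[OF c(1)] by simp
      moreover have "pw z (persp z) b1 c" using b(3) by (auto intro: pw_base persp_sym)
      ultimately show "pw z (persp z) b a" using pw_sum[OF _ _ b(1) c(1)] by blast
    next
      fix b a assume "R b a \<and> a \<le> sup y w" and aw: "inf a w = z"
      then obtain v where a: "a \<le> sup y w" and v: "persp z b v" "b \<le> y" "v \<le> w" "persp z v a" "z \<le> a" "z \<le> b" "z \<le> v" using RE by blast
      \<comment> \<open>The projection of \<open>a\<close> to \<open>y\<close> along \<open>w\<close>.\<close>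
      let ?s = "inf (sup a w) y"
      have "inf (sup a w) (sup y w) = sup ?s w" by (rule modular_law) simp
      moreover have "inf (sup a w) (sup y w) = sup a w" using a by (intro inf.absorb1) simp
      ultimately have sw: "sup a w = sup ?s w" by simp
      have zs': "z \<le> ?s" using v(5) zs by (auto intro: le_supI1)
      have "inf ?s w = z" by (rule disjoint_mono[OF d]) (use zs zs' in auto)
      then have as: "persp z a ?s" using perspI aw sw by metis
      have D: "Delta z ?s = Delta z b"
        using Delta_persp[OF as] Delta_persp[OF v(1)] Delta_persp[OF v(4)] by simp
      obtain s0 b0 c where c: "oplus z s0 c ?s" "oplus z b0 c b" "Delta z s0 = Delta z b0" "hpersp_dim (Delta z s0)"
        using common_part[OF yw d inf.cobounded2 v(2) zs' v(6) D] that by metis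
      obtain a0 a1 where a: "oplus z a0 a1 a" "persp z s0 a0" "persp z c a1"
        using persp_split[OF persp_sym[OF as] c(1)] .
      have "Delta z b0 = Delta z a0" using Delta_persp[OF a(2)] c by simp
      then have "pw z (persp z) b0 a0"
        using hpersp_dim_pw[of z b0 a0] c oplus_le(3)[OF a(1)] oplus_le(3)[OF c(2)] by simp
      moreover have "pw z (persp z) c a1" using a(3) by (rule pw_base)
      ultimately show "pw z (persp z) b a" using pw_sum[OF _ _ c(2) a(1)] by blast
    qed (use a in auto)
  qed
qed

text \<open>
  On \<open>y \<and> w\<close> the first perspectivity is the identity; off it the first two elements are disjoint.
\<close>

lemma persp_persp:
  fixes x y w :: 'a
  assumes yw: "persp z y w" and wx: "persp z w x"
  shows "pw z (persp z) y x"
proof -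
  let ?m = "inf y w"
  have m: "z \<le> ?m" using persp_le[OF yw] by simp
  obtain y' where y': "oplus z ?m y' y" using sectional_complement_exists[OF m inf.cobounded1] .
  obtain w' where w': "oplus z ?m w' w" using sectional_complement_exists[OF m inf.cobounded2] .
  obtain x0 x1 where x: "oplus z x0 x1 x" "persp z ?m x0" "persp z w' x1" using persp_split[OF wx w'] .
  have "inf y' w' = inf y' (inf ?m w')"
    using oplus_le(2)[OF y'] oplus_le(2)[OF w'] by (metis inf.absorb1 inf.assoc inf.commute inf.left_commute)
  also have "\<dots> = z" using w' oplus_le(4)[OF y'] by (simp add: oplus_def inf.absorb2)
  finally have "inf y' w' = z" .
  moreover have "persp z y' w'" using persp_differences[OF yw y' w'] .
  ultimately have "pw z (persp z) y' x1" using persp_persp_disjoint x(3) by blast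
  then show ?thesis using pw_sum[OF pw_base[of "persp z", OF x(2)] _ y' x(1)] by blast
qed

lemma chain_pw_persp:
  fixes x y :: 'a
  assumes "(persp z)\<^sup>+\<^sup>+ x y" shows "pw z (persp z) x y"
  using assms
proof (induction rule: tranclp_induct)
  case (base y) then show ?case by (rule pw_base)
next
  case (step y w)
  show ?case by (rule pw_bind[OF pw_persp[OF step.IH step.hyps(2)]]) (auto intro: persp_persp)
qed

text \<open>
  Pass to a smaller zero, where there are chains, and return by \<open>persp_lower_iff\<close>.
\<close>

lemma Delta_eq_persp:
  fixes x y :: 'a
  assumes "inf x y = z" "Delta z x = Delta z y" shows "persp z x y"
proof -
  have le: "z \<le> x" "z \<le> y" using disjoint_ge[OF assms(1)] by auto
  obtain w0 where w0: "\<And>w x' y'. w \<le> w0 \<Longrightarrow> oplus w z x' x \<Longrightarrow> oplus w z y' y \<Longrightarrow> appr w x' y'"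
    using Delta_eq_imp_appr[OF assms(2) le] by blast
  let ?w = "inf w0 z"
  have w: "?w \<le> w0" "?w \<le> z" by auto
  obtain x' where x': "oplus ?w z x' x" using sectional_complement_exists[OF w(2) le(1)] .
  obtain y' where y': "oplus ?w z y' y" using sectional_complement_exists[OF w(2) le(2)] .
  have "pw ?w (persp ?w) x' y'"
    using w0[OF w(1) x' y'] unfolding appr_def by (rule pw_bind) (rule chain_pw_persp)
  then have "persp ?w x' y'"
    using pw_persp_disjoint indep_complements(1)[OF x' y' assms(1)] by blast
  then show ?thesis using persp_lower_iff[OF x' y' assms(1)] by blast
qed

lemma hpersp_dim_all: "hpersp_dim (\<delta> :: 'a Dim)"
  unfolding hpersp_dim_def persp_dim_def using Delta_eq_persp by metis

end

section \<open>Normality\<close>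

lemma perspective_persp:
  fixes x y :: "'a::relatively_complemented_lattice"
  assumes "perspective K x y" "\<forall>t\<in>K. z \<le> t" shows "persp z x y"
proof -
  obtain t where t: "z \<le> x" "z \<le> y" "z \<le> t" "inf x t = inf y t" "sup x t = sup y t"
    using assms by (auto simp: perspective_def)
  have "z \<le> inf x t" using t by simp
  then obtain s where s: "oplus z (inf x t) s t" using sectional_complement_exists inf.cobounded2 by metis
  have st: "s \<le> t" using oplus_le[OF s] by simp
  have "inf x s = inf (inf x t) s" using st by (metis inf.absorb2 inf.assoc)
  moreover have "inf y s = inf (inf y t) s" using st by (metis inf.absorb2 inf.assoc)
  ultimately have "inf x s = z" "inf y s = z" using s t by (auto simp: oplus_def)
  moreover have "sup x s = sup x t" using s by (metis oplus_def sup.assoc sup_inf_absorb)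
  moreover have "sup y s = sup y t" using s t(4) by (metis oplus_def sup.assoc sup_inf_absorb)
  ultimately show ?thesis using t perspI by metis
qed

lemma persp_perspective_UNIV: "persp z x y \<Longrightarrow> perspective UNIV x y"
  unfolding persp_def perspective_def by (metis UNIV_I)

lemma persp_perspective_ivl:
  fixes x y :: "'a::modular_lattice"
  assumes "persp z x y" "x \<le> b" "y \<le> b" shows "perspective {z..b} x y"
proof -
  obtain s where "inf x s = z" "inf y s = z" "sup x s = sup x y" "sup y s = sup x y" "s \<le> sup x y"
    using persp_axis[OF assms(1)] .
  then show ?thesis using assms(2,3) disjoint_ge persp_le[OF assms(1)]
    unfolding perspective_def by (metis atLeastAtMost_iff le_supI order_trans)
qed

lemma Delta_finite_oplus: "finite_oplus z f n a \<Longrightarrow> Delta z a = (\<Sum>i<n. Delta z (f i))"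
  by (induction n arbitrary: a) (auto simp: Delta_D0 Delta_oplus)

lemma decomp_projective_Delta:
  fixes a b :: "'a::relatively_complemented_lattice"
  assumes "decomp_projective UNIV z a b" "\<forall>x. z \<le> x"
  shows "Delta z a = Delta z b"
proof -
  obtain n f g where *: "finite_oplus z f n a" "finite_oplus z g n b" "\<forall>i<n. projective UNIV (f i) (g i)"
    using assms by (auto simp: decomp_projective_def)
  have "Delta z x = Delta z y" if "projective UNIV x y" for x y
    using that unfolding projective_def
    by (induction rule: tranclp_induct) (use assms(2) perspective_persp Delta_persp in \<open>metis\<close>)+
  then have "(\<Sum>i<n. Delta z (f i)) = (\<Sum>i<n. Delta z (g i))" using * by (intro sum.cong) auto
  then show ?thesis using * by (simp add: Delta_finite_oplus)
qed

lemma decomp_projective_two: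
  assumes "oplus z a0 a1 a" "oplus z b0 b1 b" "perspective UNIV a0 b0" "perspective UNIV a1 b1" "\<forall>x. z \<le> x"
  shows "decomp_projective UNIV z a b"
  unfolding decomp_projective_def projective_def
  by (rule exI[of _ 2], rule exI[of _ "\<lambda>i. if i = 0 then a0 else a1"], rule exI[of _ "\<lambda>i. if i = 0 then b0 else b1"])
    (use assms in \<open>auto simp: numeral_2_eq_2 oplus_def inf.absorb1 sup.absorb2 intro: tranclp.r_into_trancl\<close>)

text \<open>
  Equality of dimensions refines by \<open>Delta_eq_sum_refine\<close>, and the summands found there stay in the
  interval. Over a bounded interval the axis of a perspectivity may be taken below the join, which
  keeps it in the interval as well.
\<close>

lemma normal_equivalence_Delta:
  fixes a b :: "'a::{modular_lattice, relatively_complemented_lattice}"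
  assumes "\<And>x y :: 'a. inf x y = a \<Longrightarrow> Delta a x = Delta a y \<Longrightarrow> persp a x y"
  shows "normal_equivalence {a..b} a {(x, y). x \<in> {a..b} \<and> y \<in> {a..b} \<and> Delta a x = Delta a y}"
    (is "normal_equivalence ?K a ?R")
  unfolding normal_equivalence_def
proof (intro conjI ballI impI)
  show "equiv ?K ?R" by (intro equivI refl_onI symI transI) auto
next
  fix x x' y y' z z' assume "z \<in> ?K" "z' \<in> ?K" "(x, x') \<in> ?R \<and> (y, y') \<in> ?R \<and> oplus a x y z \<and> oplus a x' y' z'"
  then show "(z, z') \<in> ?R" using Delta_oplus[of a x y z] Delta_oplus[of a x' y' z'] by auto
next
  fix y x0 x1 z assume x: "x0 \<in> ?K" "x1 \<in> ?K" and *: "oplus a x0 x1 z \<and> (y, z) \<in> ?R"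
  then have "Delta a y = Delta a x0 + Delta a x1" "a \<le> y" using Delta_oplus by auto
  then obtain y0 y1 where y: "oplus a y0 y1 y" "Delta a y0 = Delta a x0" "Delta a y1 = Delta a x1"
    by (rule Delta_eq_sum_refine)
  moreover have "y0 \<in> ?K" "y1 \<in> ?K" using oplus_le[OF y(1)] * by auto
  ultimately show "\<exists>y0\<in>?K. \<exists>y1\<in>?K. (y0, x0) \<in> ?R \<and> (y1, x1) \<in> ?R \<and> oplus a y0 y1 y" using x by blast
next
  fix x y assume "x \<in> ?K" "y \<in> ?K" "perspective ?K x y"
  moreover from this(3) have "persp a x y" by (rule perspective_persp) simp
  ultimately show "(x, y) \<in> ?R" using Delta_persp by blast
next
  fix x y assume "x \<in> ?K" "y \<in> ?K" "perp a x y \<and> (x, y) \<in> ?R"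
  then show "perspective ?K x y" using assms[of x y] by (auto simp: perp_def intro: persp_perspective_ivl)
qed

theorem theorem12p19:
  assumes "\<forall>x y z :: ('a::{modular_lattice, relatively_complemented_lattice}) Dim.
     x + z = y + z \<longrightarrow> (\<exists>t. alg_le (t + t) z \<and> x + t = y + t)"
  shows "normal_lattice TYPE('a) \<and>
    (\<forall>zr::'a. (\<forall>x. zr \<le> x) \<longrightarrow>
      (\<forall>a b.
        (decomp_projective UNIV zr a b \<longleftrightarrow>
          (\<exists>a0 a1 b0 b1. oplus zr a0 a1 a \<and> oplus zr b0 b1 b \<and>
            perspective UNIV a0 b0 \<and> perspective UNIV a1 b1)) \<and>
        (decomp_projective UNIV zr a b \<longrightarrow>
          (\<forall>a' b'. sectional_complement zr (inf a b) a a' \<and>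
                   sectional_complement zr (inf a b) b b' \<longrightarrow>
            (\<exists>a0 a1 b0 b1. oplus zr a0 a1 a \<and> oplus zr b0 b1 b \<and>
              perspective UNIV a0 b0 \<and> perspective UNIV a1 b1 \<and>
              perp zr a0 b0 \<and> a' \<le> a0 \<and> b' \<le> b0 \<and>
              a1 \<le> inf a b \<and> b1 \<le> inf a b)))))"
proof (intro conjI allI impI)
  show "normal_lattice TYPE('a)"
    unfolding normal_lattice_def normal_with_zero_def
    using normal_equivalence_Delta Delta_eq_persp[OF assms] by blast
next
  fix zr a b :: 'a assume zr: "\<forall>x. zr \<le> x"
  have refined: "\<exists>a0 a1 b0 b1. oplus zr a0 a1 a \<and> oplus zr b0 b1 b \<and>
      perspective UNIV a0 b0 \<and> perspective UNIV a1 b1 \<and>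
      perp zr a0 b0 \<and> a' \<le> a0 \<and> b' \<le> b0 \<and> a1 \<le> inf a b \<and> b1 \<le> inf a b"
    if "decomp_projective UNIV zr a b" "oplus zr (inf a b) a' a" "oplus zr (inf a b) b' b" for a' b'
    using hpersp_dim_decomposition[OF assms hpersp_dim_all[OF assms] decomp_projective_Delta[OF that(1) zr] that(2,3)]
    unfolding perp_def by (blast intro: persp_perspective_UNIV)
  show "decomp_projective UNIV zr a b \<longleftrightarrow> (\<exists>a0 a1 b0 b1. oplus zr a0 a1 a \<and> oplus zr b0 b1 b \<and>
      perspective UNIV a0 b0 \<and> perspective UNIV a1 b1)"
  proof
    assume d: "decomp_projective UNIV zr a b"
    obtain a' where a': "oplus zr (inf a b) a' a" using sectional_complement_exists zr inf.cobounded1 by metis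
    obtain b' where b': "oplus zr (inf a b) b' b" using sectional_complement_exists zr inf.cobounded2 by metis
    from refined[OF d a' b'] show "\<exists>a0 a1 b0 b1. oplus zr a0 a1 a \<and> oplus zr b0 b1 b \<and>
      perspective UNIV a0 b0 \<and> perspective UNIV a1 b1" by blast
  qed (use decomp_projective_two zr in blast)
  show "\<exists>a0 a1 b0 b1. oplus zr a0 a1 a \<and> oplus zr b0 b1 b \<and>
      perspective UNIV a0 b0 \<and> perspective UNIV a1 b1 \<and>
      perp zr a0 b0 \<and> a' \<le> a0 \<and> b' \<le> b0 \<and> a1 \<le> inf a b \<and> b1 \<le> inf a b"
    if "decomp_projective UNIV zr a b"
      "sectional_complement zr (inf a b) a a' \<and> sectional_complement zr (inf a b) b b'" for a' b'
    using refined that by (simp add: sectional_complement_def)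
qed

end
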